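(* Let $C:[0,1]\to\mathbb{R}$ be continuously differentiable and suppose that $t\mapsto tC'(t)$ is strictly increasing on $[0,1]$. Put $c(x,y,z)=C(xyz)$ on $[0,1]^3$. Then a triple $(f,g,h)$ of functions $[0,1]\to\mathbb{R}$ is a dual solution for the cost $c$ if and only if there exist real constants $C_f,C_g,C_h$ such that $$C_f+C_g+C_h=C(0)-2\int_0^1\lambda(t)\,C'(t\lambda(t))\,dt,$$ and for all $x,y,z\in[0,1]$ $$f(x)\le\int_0^x\lambda(t)\,C'(t\lambda(t))\,dt+C_f,\quad g(y)\le\int_0^y\lambda(t)\,C'(t\lambda(t))\,dt+C_g,\quad h(z)\le\int_0^z\lambda(t)\,C'(t\lambda(t))\,dt+C_h,$$ where in each of these three inequalities equality holds Lebesgue-almost everywhere on $[0,1]$.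
   Context: Constants: $l\approx 0.0945$ is the unique root in $(0,1/4)$ of the equation $9t+\ln(1-2t)-\ln t-3=0$, and $r=1-2l$. The function $\lambda:[0,1]\to\mathbb{R}$ is $\lambda(x)=(1-2x)^2$ for $x\in[0,l)$, $\lambda(x)=lr^2/x$ for $x\in[l,r)$, $\lambda(x)=\tfrac12x(1-x)$ for $x\in[r,1]$. A dual solution for the cost $c$ is a triple of Lebesgue integrable functions $f,g,h:[0,1]\to\mathbb{R}$ with $f(x)+g(y)+h(z)\le c(x,y,z)$ for all $x,y,z\in[0,1]$ that maximizes $\int_0^1 f+\int_0^1 g+\int_0^1 h$ (with respect to Lebesgue measure) among all such triples. *)

theory Defs
  imports "HOL-Analysis.Analysis"
begin

definition l_const :: real where
  "l_const = (THE t. 0 < t \<and> t < 1/4 \<and> 9 * t + ln (1 - 2 * t) - ln t - 3 = 0)"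

definition r_const :: real where
  "r_const = 1 - 2 * l_const"

text \<open>Functions on \<open>[0,1]\<close> are represented by total functions on the reals; only their values on
  \<open>[0,1]\<close> matter here and below.\<close>

definition lam :: "real \<Rightarrow> real" where
  "lam x =
    (if x < l_const then (1 - 2 * x)^2
     else if x < r_const then l_const * r_const^2 / x
     else 1/2 * x * (1 - x))"

text \<open>Lebesgue (not just Borel) measurability is used throughout: the integrability of \<open>f\<close>, \<open>g\<close>, \<open>h\<close>
  is taken with respect to the completed measure, so that it is stable under changes on arbitrary
  null sets. The inequality constraint, in contrast, is imposed at every point.\<close>

definition dual_feasible ::
  "(real \<Rightarrow> real \<Rightarrow> real \<Rightarrow> real) \<Rightarrow> (real \<Rightarrow> real) \<Rightarrow> (real \<Rightarrow> real) \<Rightarrow> (real \<Rightarrow> real) \<Rightarrow> bool" where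
  "dual_feasible c f g h \<longleftrightarrow>
    integrable (lebesgue_on {0..1}) f \<and>
    integrable (lebesgue_on {0..1}) g \<and>
    integrable (lebesgue_on {0..1}) h \<and>
    (\<forall>x\<in>{0..1}. \<forall>y\<in>{0..1}. \<forall>z\<in>{0..1}. f x + g y + h z \<le> c x y z)"

definition dual_value :: "(real \<Rightarrow> real) \<Rightarrow> (real \<Rightarrow> real) \<Rightarrow> (real \<Rightarrow> real) \<Rightarrow> real" where
  "dual_value f g h =
    integral\<^sup>L (lebesgue_on {0..1}) f + integral\<^sup>L (lebesgue_on {0..1}) g
    + integral\<^sup>L (lebesgue_on {0..1}) h"

definition dual_solution ::
  "(real \<Rightarrow> real \<Rightarrow> real \<Rightarrow> real) \<Rightarrow> (real \<Rightarrow> real) \<Rightarrow> (real \<Rightarrow> real) \<Rightarrow> (real \<Rightarrow> real) \<Rightarrow> bool" where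
  "dual_solution c f g h \<longleftrightarrow>
    dual_feasible c f g h \<and>
    (\<forall>f' g' h'. dual_feasible c f' g' h' \<longrightarrow> dual_value f' g' h' \<le> dual_value f g h)"

text \<open>\<open>lam_potential D x\<close> is the integral of \<open>\<lambda>(t) D(t \<lambda>(t))\<close> over \<open>[0,x]\<close>; \<open>D\<close> will be the
  derivative of \<open>C\<close>.\<close>

definition lam_potential :: "(real \<Rightarrow> real) \<Rightarrow> real \<Rightarrow> real" where
  "lam_potential D x = (LINT t|lebesgue_on {0..x}. lam t * D (t * lam t))"

end

theory Submission
  imports Defs
begin

text \<open>
  Call \<open>(x, y, z)\<close> a contact point if \<open>y z = \<lambda>(x)\<close>, \<open>x z = \<lambda>(y)\<close> and \<open>x y = \<lambda>(z)\<close>. These are the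
  points \<open>(t, 1 - 2t, 1 - 2t)\<close> with \<open>t \<le> l\<close>, their permutations, and the points of \<open>[l, r]\<^sup>3\<close> with
  \<open>x y z = l r\<^sup>2\<close>. Let \<open>F\<close> be the potential and \<open>K = C(0) - 2 F(1)\<close>. Since \<open>t C'(t)\<close> is strictly
  increasing, a minimiser of \<open>C(x y z) - F x - F y - F z\<close> over the cube is a contact point, and at
  contact points the value is \<open>K\<close>; so the potential is feasible.

  Optimality only uses the inequality at contact points. It amounts to \<open>\<integral> \<phi> \<le> 0\<close> for every
  continuous \<open>\<phi>\<close> with \<open>\<phi> x + \<phi> y + \<phi> z \<le> 0\<close> at contact points. The outer contact points account for
  \<open>[0, l] \<union> [r, 1]\<close>. On \<open>[l, r]\<close> the substitution \<open>x = r e\<^sup>-\<^sup>p\<close> turns the contact set into a simplex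
  \<open>p + q + s = L\<close> and Lebesgue measure into \<open>e\<^sup>-\<^sup>p dp\<close>, with mean \<open>L/3\<close> by the equation defining \<open>l\<close>;
  the inequality is then an explicit positive combination of averages over segments.

  For uniqueness, an optimal triple is dominated by a continuous one (\<open>c\<close>-conjugation) with the same
  integrals. Optimality forces a contact point with equality over every \<open>x\<close>, which gives
  \<open>f x' - f x \<le> C(x' \<lambda>(x)) - C(x \<lambda>(x))\<close> for all \<open>x, x'\<close> and therefore \<open>f' = F'\<close>.
\<close>

subsection \<open>A mixing inequality for the truncated exponential density\<close>

text \<open>The range is that of \<open>y = p - L/2\<close> for
  \<open>0 \<le> p \<le> L \<le> 11/5\<close>. The bound makes the Lagrange remainders in
  \<open>cosh_sinh_Taylor\<close> numerical: 1/360 is 2/720 and 1/60 is 2/120.\<close>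

lemma cosh_le_2: fixes t :: real assumes "\<bar>t\<bar> \<le> 11/10" shows "cosh t \<le> 2"
proof -
  have "exp (11/10::real) ^ 10 = exp 1 ^ 11"
    by (simp flip: exp_of_nat_mult)
  also have "\<dots> \<le> (272/100) ^ 11"
    using e_less_272 by (intro power_mono) auto
  also have "\<dots> \<le> (31/10) ^ 10"
    by (simp add: power_numeral_reduce)
  finally have "exp (11/10::real) \<le> 31/10"
    using power_mono_iff[of "exp (11/10::real)" "31/10" 10] by simp
  moreover have "(2::real) \<le> exp (11/10)"
    using exp_ge_add_one_self[of "11/10::real"] by simp
  then have "exp (-(11/10::real)) \<le> 1/2"
    by (simp add: exp_minus field_simps)
  ultimately have "cosh (11/10::real) \<le> 2"
    by (simp add: cosh_def)
  moreover have "cosh t = cosh \<bar>t\<bar>"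
    by (simp add: abs_if)
  moreover have "cosh \<bar>t\<bar> \<le> cosh (11/10::real)"
    using assms by (subst cosh_real_nonneg_le_iff) auto
  ultimately show ?thesis by simp
qed

lemma cosh_sinh_Taylor:
  fixes y :: real
  assumes "0 \<le> y" "y \<le> 11/10"
  shows "1 + y^2/2 + y^4/24 \<le> cosh y" and "cosh y \<le> 1 + y^2/2 + y^4/24 + y^6/360"
    and "y + y^3/6 + y^5/120 \<le> sinh y" and "sinh y \<le> y + y^3/6 + y^5/60"
proof -
  have d: "DERIV (if even m then cosh else sinh) t :> (if even (Suc m) then cosh else sinh) t"
    for m and t :: real by (auto intro!: derivative_eq_intros)
  have d': "DERIV (if even m then sinh else cosh) t :> (if even (Suc m) then sinh else cosh) t"
    for m and t :: real by (auto intro!: derivative_eq_intros)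
  obtain t where t: "\<bar>t\<bar> \<le> \<bar>y\<bar>" "cosh y = (\<Sum>m<6. (if even m then cosh else sinh) 0 / fact m * y^m) + cosh t / fact 6 * y^6"
    using Maclaurin_all_le_objl[of "\<lambda>m. if even m then cosh else sinh" cosh y 6] d by auto
  obtain u where u: "\<bar>u\<bar> \<le> \<bar>y\<bar>" "sinh y = (\<Sum>m<5. (if even m then sinh else cosh) 0 / fact m * y^m) + cosh u / fact 5 * y^5"
    using Maclaurin_all_le_objl[of "\<lambda>m. if even m then sinh else cosh" sinh y 5] d' by auto
  have s6: "{..<6} = {0, 1, 2, 3, 4, 5::nat}" and s5: "{..<5} = {0, 1, 2, 3, 4::nat}" by auto
  have t': "cosh y = 1 + y^2/2 + y^4/24 + cosh t * (y^6/720)"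
    using t(2) unfolding s6 by (simp add: fact_numeral)
  have u': "sinh y = y + y^3/6 + cosh u * (y^5/120)"
    using u(2) unfolding s5 by (simp add: fact_numeral)
  have "0 \<le> cosh t * (y^6/720)" "cosh t * (y^6/720) \<le> 2 * (y^6/720)"
    using mult_right_mono[of "cosh t" 2 "y^6/720"] cosh_le_2[of t] t(1) assms by auto
  then show "1 + y^2/2 + y^4/24 \<le> cosh y" "cosh y \<le> 1 + y^2/2 + y^4/24 + y^6/360"
    unfolding t' by auto
  have "1 * (y^5/120) \<le> cosh u * (y^5/120)" "cosh u * (y^5/120) \<le> 2 * (y^5/120)"
    using mult_right_mono[of 1 "cosh u" "y^5/120"] mult_right_mono[of "cosh u" 2 "y^5/120"]
      cosh_real_ge_1[of u] cosh_le_2[of u] u(1) assms by auto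
  then show "y + y^3/6 + y^5/120 \<le> sinh y" "sinh y \<le> y + y^3/6 + y^5/60"
    unfolding u' by auto
qed

text \<open>
  Where the weights come from. Let \<open>\<phi> p + \<phi> q + \<phi> s \<le> 0\<close> on the simplex \<open>p + q + s = L\<close> and let \<open>I\<close> be
  the primitive of \<open>\<phi>\<close>. Averaging over the line where \<open>p\<close> is fixed gives
  \<open>(L - p) \<phi> p + 2 I (L - p) \<le> 0\<close>; averaging over the segment from a vertex to the point dividing
  the opposite edge as \<open>x : L - x\<close> gives \<open>I L / L + I x / x + I (L - x) / (L - x) \<le> 0\<close>. Integrated
  against a weight \<open>a p\<close> and an even (about \<open>L/2\<close>) weight \<open>x (L - x) s x\<close>, these add up to
  \<open>\<integral> e\<^sup>-\<^sup>p \<phi> p\<close>, up to a factor, as soon as \<open>weight_identity\<close> holds. Its solutions are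
  parametrised by the even part of \<open>a\<close>, which is free; a multiple of \<open>(p - L/2)\<^sup>2\<close> is taken, with the
  coefficient that cancels the cubic Taylor term of \<open>a\<close>, and a multiple of \<open>p - L/3\<close>, which
  contributes nothing, is subtracted to cancel the linear term. Both functions are written in the
  variable \<open>y = p - L/2\<close>.
\<close>

definition strip_weight :: "real \<Rightarrow> real \<Rightarrow> real" where
  "strip_weight L y = (2/L) * (L/2 * sinh y - y * cosh y)
     + (6 - L)/60 * (10 * y^3/L + y^2 + L^2/6) - (L - 2)/L * (y + L/6)"

definition ray_weight :: "real \<Rightarrow> real \<Rightarrow> real" where
  "ray_weight L y = (L/2 * cosh y - y * sinh y)/L + (6 - L)/60 * (10 * y^2/L - L/2)"

text \<open>\<open>R\<close> is \<open>y * cosh y - L/2 * sinh y\<close> minus its Taylor terms up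
  to degree 3, hence of order \<open>y^5\<close>. The rest of the weight is a nonnegative constant
  plus a positive multiple of \<open>y^2\<close>, which absorbs \<open>R\<close> for
  \<open>y \<ge> 0\<close>. Since \<open>R\<close> is odd and enters with a minus sign, it only
  helps for \<open>y < 0\<close>.\<close>

lemma strip_weight_nonneg:
  assumes L: "21/10 \<le> L" "L \<le> 11/5" and y: "\<bar>y\<bar> \<le> L/2"
  shows "0 \<le> strip_weight L y"
proof -
  define R where "R y = y * cosh y - L/2 * sinh y - (1 - L/2) * y - (1/2 - L/12) * y^3" for y
  have eq: "strip_weight L y = (6 - L)/60 * y^2 + ((6 - L) * L^2 - 60 * (L - 2))/360 - (2/L) * R y"
    using L by (simp add: strip_weight_def R_def field_simps)
  have base: "0 \<le> (6 - L) * L^2 - 60 * (L - 2)"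
  proof -
    have "19/5 * (21/10)^2 \<le> (6 - L) * L^2"
      using L by (intro mult_mono power_mono) auto
    then show ?thesis using L by (simp add: power2_eq_square)
  qed
  \<comment> \<open>There is room to spare: the available coefficient \<open>(6 - L)/60\<close> is
    at least 19/300.\<close>
  have "(2/L) * R y \<le> 1/21 * y^2"
  proof (cases "0 \<le> y")
    case True
    with y L have y': "0 \<le> y" "y \<le> 11/10" by auto
    note T = cosh_sinh_Taylor[OF y']
    have "y * cosh y \<le> y * (1 + y^2/2 + y^4/24 + y^6/360)"
      using T y' by (intro mult_left_mono) auto
    moreover have "L/2 * sinh y \<ge> L/2 * (y + y^3/6 + y^5/120)"
      using T L by (intro mult_left_mono) auto
    ultimately have "R y \<le> y * (1 + y^2/2 + y^4/24 + y^6/360) - L/2 * (y + y^3/6 + y^5/120)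
       - (1 - L/2) * y - (1/2 - L/12) * y^3"
      unfolding R_def by linarith
    also have "\<dots> = y^2 * (y^3 * (1/24 - L/240) + y^5/360)"
      by (simp add: field_simps eval_nat_numeral)
    also have "\<dots> \<le> y^2 * ((11/10)^3 * (79/2400) + (11/10)^5/360)"
      using y' L by (intro mult_left_mono add_mono mult_mono divide_right_mono power_mono) auto
    also have "\<dots> \<le> y^2 * (1/20)"
      by (intro mult_left_mono) (auto simp: eval_nat_numeral)
    finally have R: "R y \<le> y^2 * (1/20)" .
    have "(2/L) * R y \<le> (2/L) * (y^2 * (1/20))" 
      using R L by (intro mult_left_mono) auto
    also have "\<dots> \<le> (20/21) * (y^2 * (1/20))"
      using L by (intro mult_right_mono) (auto simp: field_simps)
    finally show ?thesis by simp
  next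
    case False
    define z where "z = - y"
    with y L False have z: "0 \<le> z" "z \<le> 11/10" by auto
    note T = cosh_sinh_Taylor[OF z]
    have "z * cosh z \<ge> z * (1 + z^2/2 + z^4/24)"
      using T z by (intro mult_left_mono) auto
    moreover have "L/2 * sinh z \<le> L/2 * (z + z^3/6 + z^5/60)"
      using T L by (intro mult_left_mono) auto
    ultimately have "R z \<ge> z * (1 + z^2/2 + z^4/24) - L/2 * (z + z^3/6 + z^5/60)
       - (1 - L/2) * z - (1/2 - L/12) * z^3"
      unfolding R_def by linarith
    also have "z * (1 + z^2/2 + z^4/24) - L/2 * (z + z^3/6 + z^5/60)
       - (1 - L/2) * z - (1/2 - L/12) * z^3 = z^5 * (1/24 - L/120)"
      by (simp add: field_simps eval_nat_numeral)
    finally have "R z \<ge> z^5 * (1/24 - L/120)" .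
    moreover have "z^5 * (1/24 - L/120) \<ge> 0" using z L by simp
    moreover have "R y = - R z" by (simp add: R_def z_def)
    ultimately have "R y \<le> 0" by simp
    then have "(2/L) * R y \<le> 0" using L by (simp add: divide_simps)
    also have "0 \<le> 1/21 * y^2" by simp
    finally show ?thesis .
  qed
  also have "\<dots> \<le> (6 - L)/60 * y^2"
    using L by (intro mult_right_mono) auto
  also have "\<dots> \<le> (6 - L)/60 * y^2 + ((6 - L) * L^2 - 60 * (L - 2))/360"
    using base by simp
  finally show ?thesis unfolding eq by simp
qed

lemma ray_weight_minus [simp]: "ray_weight L (-y) = ray_weight L y"
  by (simp add: ray_weight_def)

text \<open>With \<open>z = \<bar>y\<bar> \<le> L/2\<close>, the factor \<open>z\<close> of
  \<open>sinh z\<close> may be raised to \<open>L/2\<close>, and then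
  \<open>cosh z - sinh z = exp (- z) \<ge> 1 - z\<close>. The resulting lower bound is a quadratic
  in \<open>z\<close> whose minimum, at 33/38, is positive.\<close>

lemma ray_weight_nonneg:
  assumes L: "21/10 \<le> L" "L \<le> 11/5" and y: "\<bar>y\<bar> \<le> L/2"
  shows "0 \<le> ray_weight L y"
proof -
  define z where "z = \<bar>y\<bar>"
  have z: "0 \<le> z" "z \<le> L/2" using y by (auto simp: z_def)
  have "L/2 * (1 - z) \<le> L/2 * exp (- z)"
    using L exp_ge_add_one_self[of "-z"] by (intro mult_left_mono) auto
  also have "\<dots> = L/2 * cosh z - L/2 * sinh z"
    unfolding cosh_minus_sinh [symmetric] by (rule right_diff_distrib)
  also have "\<dots> \<le> L/2 * cosh z - z * sinh z"
    using z mult_right_mono[of z "L/2" "sinh z"] by simp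
  finally have "(L/2 * cosh z - z * sinh z)/L \<ge> (L/2 * (1 - z))/L"
    using L by (intro divide_right_mono) auto
  also have "(L/2 * (1 - z))/L = (1 - z)/2" using L by simp
  finally have 1: "(L/2 * cosh z - z * sinh z)/L \<ge> (1 - z)/2" .
  have "19/300 * (z^2 * (50/11)) \<le> (6 - L)/60 * (z^2 * (10/L))"
    using L by (intro mult_mono) (auto simp: field_simps)
  moreover have "(6 - L)/60 * (L/2) \<le> 39/600 * (11/10)"
    using L by (intro mult_mono) auto
  moreover have ray_weight_split: "ray_weight L z = (L/2 * cosh z - z * sinh z)/L
     + ((6 - L)/60 * (z^2 * (10/L)) - (6 - L)/60 * (L/2))"
    by (simp add: ray_weight_def algebra_simps)
  ultimately have "ray_weight L z \<ge> (1 - z)/2 + 19/66 * z^2 - 143/2000"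
    using 1 unfolding ray_weight_split by linarith
  also have "(1 - z)/2 + 19/66 * z^2 - 143/2000 = 19/66 * (z - 33/38)^2 + (857/2000 - 33/152)"
    by (simp add: field_simps power2_eq_square)
  finally have "19/66 * (z - 33/38)^2 + (857/2000 - 33/152) \<le> ray_weight L z" .
  moreover have "0 \<le> 19/66 * (z - 33/38)^2" by simp
  ultimately have "0 \<le> ray_weight L z" by linarith
  then show ?thesis by (simp add: z_def abs_if split: if_splits)
qed

lemma strip_weight_deriv:
  "(strip_weight L has_real_derivative
     (2/L) * (L/2 * cosh y - cosh y - y * sinh y) + (6 - L)/60 * (30 * y^2/L + 2 * y) - (L - 2)/L) (at y within S)"
  unfolding strip_weight_def
  apply (cases "L = 0")
  apply (auto intro!: derivative_eq_intros simp: field_simps)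
  done

text \<open>The long bracket is the derivative of \<open>strip_weight\<close>. Up to sign, the left
  side is the coefficient of the primitive \<open>I\<close> after the strip average minus the target
  integral is integrated by parts; the right side is what the ray averages contribute after
  reflection, so the two cancel.\<close>

lemma weight_identity:
  assumes "L \<noteq> 0"
  shows "((2/L) * (L/2 * cosh y - cosh y - y * sinh y) + (6 - L)/60 * (30 * y^2/L + 2 * y) - (L - 2)/L) * (L/2 - y)
     - strip_weight L y - 2 * strip_weight L (-y) + exp (-y) = 2 * (L/2 - y) * ray_weight L y"
proof -
  have exp: "exp (-y) = cosh y - sinh y" by (simp add: cosh_minus_sinh)
  show ?thesis unfolding exp strip_weight_def ray_weight_def using assms 
    by (simp add: field_simps power2_eq_square power3_eq_cube)
qed

text \<open>In \<open>mixing_inequality\<close> this mass has to cancel a boundary term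
  \<open>I L * exp (- c)\<close>; here the condition on \<open>exp L\<close> enters.
  \<open>H\<close> is an odd primitive in the centred variable, so the integral is
  \<open>2 * H c\<close>.\<close>

lemma ray_weight_integral:
  assumes L: "0 < L" and E: "exp L * (3 - L) = 3 + 2 * L"
  shows "((\<lambda>p. p * (L - p) * ray_weight L (p - L/2)) has_integral L * exp (- L/2)) {0..L}"
proof -
  define c where "c = L/2"
  have Lc: "L = 2 * c" and c: "0 < c" using L by (auto simp: c_def)
  define H where "H y = (c^3 * sinh y - c^2 * (y * cosh y - sinh y) - c * (y^2 * sinh y - 2 * y * cosh y + 2 * sinh y)
      + y^3 * cosh y - 3 * y^2 * sinh y + 6 * y * cosh y - 6 * sinh y) / L
      + (6 - L)/60 * (2 * c * y^3 - c^3 * y - y^5/c)" for y :: real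
  have dH: "(H has_real_derivative (c + y) * (c - y) * ray_weight L y) (at y)" for y
    unfolding H_def ray_weight_def Lc using c
    by (auto intro!: derivative_eq_intros simp: field_simps eval_nat_numeral)
  have "((\<lambda>p. p * (L - p) * ray_weight L (p - L/2)) has_integral H (L - c) - H (0 - c)) {0..L}"
  proof (intro fundamental_theorem_of_calculus)
    fix p
    have e: "p * (L - p) * ray_weight L (p - L/2) = (c + (p - c)) * (c - (p - c)) * ray_weight L (p - c)"
      by (simp add: Lc)
    have "((\<lambda>p. p - c) has_real_derivative 1) (at p within {0..L})"
      by (auto intro!: derivative_eq_intros)
    from DERIV_chain2[OF dH this]
    have "((\<lambda>p. H (p - c)) has_real_derivative p * (L - p) * ray_weight L (p - L/2)) (at p within {0..L})"
      unfolding e by simp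
    then show "((\<lambda>p. H (p - c)) has_vector_derivative p * (L - p) * ray_weight L (p - L/2)) (at p within {0..L})"
      by (simp add: has_real_derivative_iff_has_vector_derivative)
  qed (use L in auto)
  also have "H (L - c) - H (0 - c) = 2 * H c"
    unfolding Lc H_def by (simp add: add_divide_distrib diff_divide_distrib algebra_simps)
  also have "\<dots> = (cosh c * (2 * c^2 + 6 * c) - sinh c * (2 * c^2 + 2 * c + 6)) / c"
    unfolding H_def Lc using c by (simp add: field_simps eval_nat_numeral)
  \<comment> \<open>The hypothesis on \<open>exp L\<close> in hyperbolic form, for
    \<open>L = 2 * c\<close>.\<close>
  also have "3 * c * cosh c = (c + 3) * sinh c"
  proof -
    have "exp c * exp c * (3 - 2 * c) = 3 + 4 * c"
      using E by (simp add: Lc flip: exp_add)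
    then have "exp c * (3 - 2 * c) = (3 + 4 * c) * exp (- c)"
      by (simp add: exp_minus field_simps)
    then show ?thesis by (simp add: cosh_def sinh_def field_simps)
  qed
  then have "cosh c * (2 * c^2 + 6 * c) - sinh c * (2 * c^2 + 2 * c + 6) = 2 * c^2 * (cosh c - sinh c)"
    by (simp add: algebra_simps power2_eq_square)
  then have "(cosh c * (2 * c^2 + 6 * c) - sinh c * (2 * c^2 + 2 * c + 6)) / c = L * exp (- L/2)"
    using c by (simp add: Lc cosh_minus_sinh power2_eq_square)
  finally show ?thesis .
qed

section \<open>Reflection, scaling and sign of integrals over an interval\<close>

lemma has_integral_reflect_interval:
  fixes k :: "real \<Rightarrow> real"
  assumes "(k has_integral i) {0..L}"
  shows "((\<lambda>p. k (L - p)) has_integral i) {0..L}"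
proof -
  have "((\<lambda>p. k (- p)) has_integral i) (cbox (- L) 0)"
    using has_integral_reflect_lemma_real[OF assms] by simp
  from has_integral_affinity'[OF this, of 1 "- L"] show ?thesis by simp
qed

lemma has_integral_antisymmetric:
  fixes k :: "real \<Rightarrow> real"
  assumes "continuous_on {0..L} k" "\<And>p. p \<in> {0..L} \<Longrightarrow> k (L - p) = - k p"
  shows "(k has_integral 0) {0..L}"
proof -
  have k: "(k has_integral integral {0..L} k) {0..L}"
    by (intro integrable_integral integrable_continuous_real assms)
  have "((\<lambda>p. - k p) has_integral integral {0..L} k) {0..L}"
    by (rule has_integral_eq[OF _ has_integral_reflect_interval[OF k]]) (use assms(2) in auto)
  from has_integral_unique[OF this has_integral_neg[OF k]] show ?thesis
    using k by simp
qed

lemma has_integral_scale_unit: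
  fixes k :: "real \<Rightarrow> real"
  assumes "0 \<le> x" "(k has_integral i) {0..x}"
  shows "((\<lambda>t. x * k (x * t)) has_integral i) {0..1}"
proof (cases "x = 0")
  case True
  then have "i = 0"
    using has_integral_unique[OF assms(2) has_integral_null_real] by simp
  then show ?thesis unfolding True by simp
next
  case False
  then have "((\<lambda>t. k (x * t)) has_integral i / x) {0..1}"
    using has_integral_affinity'[of k i 0 x x 0] assms by (simp add: divide_inverse mult.commute)
  from has_integral_mult_right[OF this, of x] show ?thesis using False by simp
qed

lemma has_integral_nonpos:
  fixes k :: "real \<Rightarrow> real"
  assumes "(k has_integral i) S" "\<And>x. x \<in> S \<Longrightarrow> k x \<le> 0"
  shows "i \<le> 0"
  using has_integral_nonneg[OF has_integral_neg[OF assms(1)]] assms(2) by simp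

text \<open>The condition on \<open>exp L\<close> says that the density \<open>e\<^sup>-\<^sup>p\<close> on \<open>[0, L]\<close> has mean \<open>L/3\<close>. The lemma is the
  dual form of the existence of a measure on the simplex \<open>p + q + s = L\<close> with all three marginals
  of this density.\<close>

lemma mixing_inequality:
  fixes \<phi> :: "real \<Rightarrow> real"
  assumes L: "21/10 \<le> L" "L \<le> 11/5" and E: "exp L * (3 - L) = 3 + 2 * L"
    and cont: "continuous_on {0..L} \<phi>"
    and le: "\<And>p q s. 0 \<le> p \<Longrightarrow> 0 \<le> q \<Longrightarrow> 0 \<le> s \<Longrightarrow> p + q + s = L \<Longrightarrow> \<phi> p + \<phi> q + \<phi> s \<le> 0"
  shows "integral {0..L} (\<lambda>p. exp (- p) * \<phi> p) \<le> 0"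
proof -
  define I where "I x = integral {0..x} \<phi>" for x
  define c where "c = L/2"
  have Lc: "L = c + c" by (simp add: c_def)
  have cont_sub: "continuous_on {0..x} \<phi>" if "x \<le> L" for x
    using cont by (rule continuous_on_subset) (use that in auto)
  have hasI: "(\<phi> has_integral I x) {0..x}" if "x \<le> L" for x
    unfolding I_def by (intro integrable_integral integrable_continuous_real cont_sub that)
  have I0: "I 0 = 0" by (simp add: I_def)
  have dI: "(I has_real_derivative \<phi> x) (at x within {0..L})" if "x \<in> {0..L}" for x
    unfolding I_def has_real_derivative_iff_has_vector_derivative
    by (rule integral_has_vector_derivative[OF cont that])
  then have contI: "continuous_on {0..L} I"
    using DERIV_continuous_on[of "{0..L}" I \<phi>] by auto
  have contI': "continuous_on {0..L} (\<lambda>p. I (L - p))"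
    by (rule continuous_on_compose2[OF contI]) (auto intro!: continuous_intros)
  have strip: "(L - p) * \<phi> p + 2 * I (L - p) \<le> 0" if p: "p \<in> {0..L}" for p
  proof -
    have *: "(\<phi> has_integral I (L - p)) {0..L - p}" using p by (intro hasI) auto
    have "((\<lambda>q. \<phi> p + \<phi> q + \<phi> (L - p - q)) has_integral (L - p) * \<phi> p + I (L - p) + I (L - p)) {0..L - p}"
      using p has_integral_const_real[of "\<phi> p" 0 "L - p"]
      by (intro has_integral_add * has_integral_reflect_interval[OF *]) auto
    then have "(L - p) * \<phi> p + I (L - p) + I (L - p) \<le> 0"
      by (rule has_integral_nonpos) (use p in \<open>auto intro!: le\<close>)
    then show ?thesis by simp
  qed
  have ray: "x * (L - x) * (I L / L) + (L - x) * I x + x * I (L - x) \<le> 0" if x: "x \<in> {0..L}" for x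
  proof (cases "x = 0 \<or> x = L")
    case True
    then show ?thesis by (auto simp: I0)
  next
    case False
    with x have x': "0 < x" "x < L" by auto
    have u: "((\<lambda>t. \<phi> (y * t)) has_integral I y / y) {0..1}" if "0 < y" "y \<le> L" for y
      using has_integral_divide[OF has_integral_scale_unit[of y \<phi> "I y"], of y] hasI[of y] that by simp
    have v: "((\<lambda>t. \<phi> (y * (1 - t))) has_integral I y / y) {0..1}" if "0 < y" "y \<le> L" for y
      by (rule has_integral_reflect_interval[OF u[OF that]])
    \<comment> \<open>The arguments sum to \<open>L\<close> and run from the point
      \<open>(0, x, L - x)\<close> of an edge to the vertex \<open>(L, 0, 0)\<close>.\<close>
    have "((\<lambda>t. \<phi> (L * t) + \<phi> (x * (1 - t)) + \<phi> ((L - x) * (1 - t))) has_integral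
        I L / L + I x / x + I (L - x) / (L - x)) {0..1}"
      using x' L by (intro has_integral_add u v) auto
    then have "I L / L + I x / x + I (L - x) / (L - x) \<le> 0"
    proof (rule has_integral_nonpos)
      fix t :: real assume "t \<in> {0..1}"
      then show "\<phi> (L * t) + \<phi> (x * (1 - t)) + \<phi> ((L - x) * (1 - t)) \<le> 0"
        using x' L by (intro le mult_nonneg_nonneg) (auto simp: algebra_simps)
    qed
    then have "x * (L - x) * (I L / L + I x / x + I (L - x) / (L - x)) \<le> 0"
      using x' by (intro mult_nonneg_nonpos) auto
    also have "x * (L - x) * (I L / L + I x / x + I (L - x) / (L - x))
       = x * (L - x) * (I L / L) + (L - x) * I x + x * I (L - x)"
    proof -
      have "L - x \<noteq> 0" "x \<noteq> 0" using x' by auto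
      then show ?thesis by (simp add: distrib_left)
    qed
    finally show ?thesis .
  qed
  let ?a = "strip_weight L" and ?s = "ray_weight L"
  have conta: "continuous_on S (\<lambda>p. ?a (f p))" if "continuous_on S f" for f :: "real \<Rightarrow> real" and S
    unfolding strip_weight_def using that by (intro continuous_intros) (use L in auto)
  have conts: "continuous_on S (\<lambda>p. ?s (f p))" if "continuous_on S f" for f :: "real \<Rightarrow> real" and S
    unfolding ray_weight_def using that by (intro continuous_intros) (use L in auto)
  \<comment> \<open>The weighted sum of the averages will split into the target integral, the ray
    mass times \<open>I L / L\<close>, the derivative \<open>B'\<close> coming from integration by
    parts, and \<open>k\<close>, which is antisymmetric about \<open>L/2\<close>.\<close>
  define B where "B p = ?a (p - c) * (L - p) * I p - I p * exp (c - p)" for p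
  define B' where "B' p = \<phi> p * (?a (p - c) * (L - p) - exp (c - p))
      + I p * (2 * (L - p) * ?s (p - c) + 2 * ?a (c - p))" for p
  define k where "k p = 2 * (?a (p - c) * I (L - p) - ?a (c - p) * I p)
      + ?s (p - c) * (p * I (L - p) - (L - p) * I p)" for p
  have "(B has_real_derivative B' p) (at p within {0..L})" if p: "p \<in> {0..L}" for p
  proof -
    define a' where "a' = (2/L) * (L/2 * cosh (p - c) - cosh (p - c) - (p - c) * sinh (p - c))
      + (6 - L)/60 * (30 * (p - c)^2/L + 2 * (p - c)) - (L - 2)/L"
    have "((\<lambda>p. p - c) has_real_derivative 1) (at p within {0..L})"
      by (auto intro!: derivative_eq_intros)
    from DERIV_chain2[OF strip_weight_deriv this, of L]
    have da: "((\<lambda>p. ?a (p - c)) has_real_derivative a') (at p within {0..L})"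
      by (simp add: a'_def)
    have "(B has_real_derivative (a' * (L - p) - ?a (p - c)) * I p + ?a (p - c) * (L - p) * \<phi> p
       - (\<phi> p * exp (c - p) - I p * exp (c - p))) (at p within {0..L})"
      unfolding B_def by (rule derivative_eq_intros da dI[OF p] refl)+ (simp add: algebra_simps)
    also have "(a' * (L - p) - ?a (p - c)) * I p + ?a (p - c) * (L - p) * \<phi> p
       - (\<phi> p * exp (c - p) - I p * exp (c - p)) = \<phi> p * (?a (p - c) * (L - p) - exp (c - p))
         + I p * (a' * (L - p) - ?a (p - c) + exp (c - p))"
      by (simp add: algebra_simps)
    also have "a' * (L - p) - ?a (p - c) + exp (c - p) = 2 * (L - p) * ?s (p - c) + 2 * ?a (c - p)"
      using weight_identity[of L "p - c"] L by (simp add: a'_def Lc)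
    finally show ?thesis unfolding B'_def .
  qed
  then have "(B' has_integral B L - B 0) {0..L}"
    using L by (intro fundamental_theorem_of_calculus)
      (auto simp: has_real_derivative_iff_has_vector_derivative)
  moreover have "B L - B 0 = - I L * exp (- c)"
    by (simp add: B_def I0 Lc)
  ultimately have hB: "(B' has_integral - I L * exp (- c)) {0..L}" by simp
  have hk: "(k has_integral 0) {0..L}"
  proof (rule has_integral_antisymmetric)
    show "continuous_on {0..L} k"
      unfolding k_def by (intro continuous_intros conta conts contI contI')
    fix p assume "p \<in> {0..L}"
    have eqs: "L - p - c = c - p" "c - (L - p) = p - c" "?s (c - p) = ?s (p - c)"
      using ray_weight_minus[of L "p - c"] by (auto simp: Lc)
    show "k (L - p) = - k p"
      unfolding k_def eqs by (simp add: algebra_simps)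
  qed
  define J where "J = integral {0..L} (\<lambda>p. exp (- p) * \<phi> p)"
  have "((\<lambda>p. exp (- p) * \<phi> p) has_integral J) {0..L}"
    unfolding J_def by (intro integrable_integral integrable_continuous_real continuous_intros cont)
  then have hJ: "((\<lambda>p. exp c * (exp (- p) * \<phi> p)) has_integral exp c * J) {0..L}"
    by (rule has_integral_mult_right)
  have hs: "((\<lambda>p. p * (L - p) * ?s (p - c) * (I L / L)) has_integral L * exp (- c) * (I L / L)) {0..L}"
    using ray_weight_integral[of L] L E by (intro has_integral_mult_left) (auto simp: c_def)
  have "((\<lambda>p. ?a (p - c) * ((L - p) * \<phi> p + 2 * I (L - p))
      + ?s (p - c) * (p * (L - p) * (I L / L) + (L - p) * I p + p * I (L - p)))
    has_integral (- I L * exp (- c) + exp c * J + L * exp (- c) * (I L / L) + 0)) {0..L}"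
    by (rule has_integral_eq[OF _ has_integral_add[OF has_integral_add[OF has_integral_add[OF hB hJ] hs] hk]])
      (simp add: B'_def k_def algebra_simps exp_diff exp_minus divide_inverse)
  then have "- I L * exp (- c) + exp c * J + L * exp (- c) * (I L / L) + 0 \<le> 0"
  proof (rule has_integral_nonpos)
    fix p assume p: "p \<in> {0..L}"
    then have y: "\<bar>p - c\<bar> \<le> L/2" by (auto simp: c_def abs_if)
    show "?a (p - c) * ((L - p) * \<phi> p + 2 * I (L - p))
      + ?s (p - c) * (p * (L - p) * (I L / L) + (L - p) * I p + p * I (L - p)) \<le> 0"
      by (rule add_nonpos_nonpos[OF mult_nonneg_nonpos[OF strip_weight_nonneg[OF L y] strip[OF p]]
            mult_nonneg_nonpos[OF ray_weight_nonneg[OF L y] ray[OF p]]])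
  qed
  \<comment> \<open>The two terms with \<open>I L\<close> cancel.\<close>
  then have "exp c * J \<le> 0" using L by simp
  then have "J \<le> 0" by (simp add: mult_le_0_iff)
  then show ?thesis by (simp add: J_def)
qed

subsection \<open>The constants and the contact set\<close>

definition l_fun :: "real \<Rightarrow> real" where
  "l_fun t = 9 * t + ln (1 - 2 * t) - ln t - 3"

lemma l_fun_deriv:
  assumes "0 < t" "t < 1/2"
  shows "(l_fun has_real_derivative (1 - 6 * t) * (3 * t - 1) / (t * (1 - 2 * t))) (at t)"
  unfolding l_fun_def using assms by (auto intro!: derivative_eq_intros simp: field_simps)

lemma l_fun_strict_antimono:
  assumes "0 < s" "s < t" "t \<le> 1/6"
  shows "l_fun t < l_fun s"
proof (rule DERIV_neg_imp_decreasing_open[OF \<open>s < t\<close>])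
  fix x assume "s < x" "x < t"
  with assms have "0 < x" "x < 1/6" by auto
  then have "DERIV l_fun x :> (1 - 6 * x) * (3 * x - 1) / (x * (1 - 2 * x))"
    "(1 - 6 * x) * (3 * x - 1) / (x * (1 - 2 * x)) < 0"
    by (auto intro!: l_fun_deriv divide_neg_pos mult_pos_neg)
  then show "\<exists>y. DERIV l_fun x :> y \<and> y < 0" by blast
next
  show "continuous_on {s..t} l_fun"
    unfolding l_fun_def using assms by (intro continuous_intros) auto
qed

text \<open>On this interval \<open>l_fun\<close> increases towards its value
  \<open>ln 2 - 3/4\<close> at 1/4, which is still negative. So the root on the decreasing branch
  below 1/6 is the only one.\<close>

lemma l_fun_neg:
  assumes "1/6 \<le> t" "t < 1/4"
  shows "l_fun t < 0"
proof -
  have "l_fun t < l_fun (1/4)"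
  proof (rule DERIV_pos_imp_increasing_open[OF \<open>t < 1/4\<close>])
    fix x assume "t < x" "x < 1/4"
    with assms have "1/6 < x" "x < 1/4" by auto
    then have "DERIV l_fun x :> (1 - 6 * x) * (3 * x - 1) / (x * (1 - 2 * x))"
      by (intro l_fun_deriv) auto
    moreover have "0 < (1 - 6 * x) * (3 * x - 1) / (x * (1 - 2 * x))"
      using \<open>1/6 < x\<close> \<open>x < 1/4\<close>
      by (intro divide_pos_pos[OF mult_neg_neg mult_pos_pos]) auto
    ultimately show "\<exists>y. DERIV l_fun x :> y \<and> 0 < y" by blast
  next
    show "continuous_on {t..1/4} l_fun"
      unfolding l_fun_def using assms by (intro continuous_intros) auto
  qed
  also have "l_fun (1/4) = ln 2 - 3/4"
    using ln_div[of 1 "2::real"] ln_div[of 1 "4::real"] ln_realpow[of "2::real" 2] by (simp add: l_fun_def)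
  also have "\<dots> < 0" using ln2_le_25_over_36 by simp
  finally show ?thesis .
qed

text \<open>The bounds are those that place \<open>3 - 9 * l_const\<close> between 21/10 and 11/5,
  as the weight estimates require. The signs of \<open>l_fun\<close> at the two ends amount to
  \<open>exp (11/5) < 37/4\<close> and \<open>ln 8 < 21/10\<close>.\<close>

lemma l_const_root: "l_fun l_const = 0" and l_const_bounds: "4/45 < l_const" "l_const < 1/10"
proof -
  have "exp (11/5::real) ^ 5 = exp 1 ^ 11"
    by (simp flip: exp_of_nat_mult)
  also have "\<dots> \<le> (272/100) ^ 11"
    using e_less_272 by (intro power_mono) auto
  also have "\<dots> < (37/4) ^ 5"
    by (simp add: power_numeral_reduce)
  finally have "exp (11/5::real) < 37/4"
    by (rule power_less_imp_less_base) simp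
  then have "ln (exp (11/5)) < ln (37/4::real)"
    by (subst ln_less_cancel_iff) auto
  then have "11/5 < ln (37/4::real)" by simp
  also have "ln (37/4::real) = ln (37/45) - ln (4/45)"
    using ln_div[of "37/45::real" "4/45"] by simp
  finally have pos: "0 < l_fun (4/45)"
    by (simp add: l_fun_def)
  have "ln (8/10::real) - ln (1/10) = ln 8"
    using ln_div[of "8/10::real" "1/10"] by simp
  also have "\<dots> = 3 * ln 2"
    using ln_realpow[of "2::real" 3] by simp
  finally have neg: "l_fun (1/10) < 0"
    using ln2_le_25_over_36 by (simp add: l_fun_def)
  have "continuous_on {4/45..1/10} l_fun"
    unfolding l_fun_def by (intro continuous_intros) auto
  with IVT2'[of l_fun "1/10" 0 "4/45"] pos neg
  obtain x where x: "4/45 \<le> x" "x \<le> 1/10" "l_fun x = 0" by auto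
  have uniq: "t = x" if t: "0 < t" "t < 1/4" "l_fun t = 0" for t
  proof (rule ccontr)
    assume "t \<noteq> x"
    moreover have "t < 1/6" using l_fun_neg[of t] t by force
    ultimately show False
      using l_fun_strict_antimono[of t x] l_fun_strict_antimono[of x t] t x by force
  qed
  have "l_const = x"
    unfolding l_const_def
    by (rule the_equality) (use x uniq in \<open>auto simp: l_fun_def\<close>)
  moreover have "x \<noteq> 4/45" "x \<noteq> 1/10" using x pos neg by (metis less_irrefl)+
  ultimately show "l_fun l_const = 0" "4/45 < l_const" "l_const < 1/10" using x by auto
qed

lemma l_const_log: "ln (r_const / l_const) = 3 - 9 * l_const"
  using l_const_root l_const_bounds by (simp add: l_fun_def r_const_def ln_div)

lemma exp_l_const: "exp (3 - 9 * l_const) = r_const / l_const"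
  using l_const_bounds by (simp flip: l_const_log add: r_const_def)

lemma r_const_bounds: "4/5 < r_const" "r_const < 37/45" and l_less_r: "l_const < r_const"
  using l_const_bounds by (auto simp: r_const_def)

section \<open>The function \<lambda>\<close>

lemma lam_lower: "x \<le> l_const \<Longrightarrow> lam x = (1 - 2 * x)^2"
  using l_const_bounds l_less_r by (auto simp: lam_def r_const_def power2_eq_square)

lemma lam_middle: "l_const \<le> x \<Longrightarrow> x \<le> r_const \<Longrightarrow> lam x = l_const * r_const^2 / x"
  using l_const_bounds r_const_bounds by (auto simp: lam_def r_const_def power2_eq_square)

lemma lam_upper: "r_const \<le> x \<Longrightarrow> lam x = x * (1 - x) / 2"
  using l_less_r by (simp add: lam_def)

lemma lam_0 [simp]: "lam 0 = 1" and lam_1 [simp]: "lam 1 = 0"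
  using l_const_bounds r_const_bounds by (auto simp: lam_lower lam_upper)

lemma unit_interval_split: "{0..1} = {0..l_const} \<union> {l_const..r_const} \<union> {r_const..1}"
  using l_const_bounds r_const_bounds by auto

lemma continuous_on_lam: "continuous_on {0..1} lam"
proof -
  have "continuous_on {0..l_const} lam \<longleftrightarrow> continuous_on {0..l_const} (\<lambda>x. (1 - 2 * x)^2)"
    by (intro continuous_on_cong) (auto simp: lam_lower)
  moreover have "continuous_on {l_const..r_const} lam \<longleftrightarrow>
      continuous_on {l_const..r_const} (\<lambda>x. l_const * r_const^2 / x)"
    by (intro continuous_on_cong) (auto simp: lam_middle)
  moreover have "continuous_on {r_const..1} lam \<longleftrightarrow> continuous_on {r_const..1} (\<lambda>x. x * (1 - x) / 2)"
    by (intro continuous_on_cong) (auto simp: lam_upper)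
  ultimately show ?thesis
    unfolding unit_interval_split using l_const_bounds
    by (intro continuous_on_closed_Un) (auto intro!: continuous_intros)
qed

lemma lam_strict_antimono:
  assumes "0 \<le> x" "x < y" "y \<le> 1"
  shows "lam y < lam x"
proof -
  have lower: "lam y < lam x" if "0 \<le> x" "x < y" "y \<le> l_const" for x y
    using that l_const_bounds by (auto simp: lam_lower intro!: power_strict_mono)
  have middle: "lam y < lam x" if "l_const \<le> x" "x < y" "y \<le> r_const" for x y
    using that l_const_bounds r_const_bounds by (auto simp: lam_middle intro!: divide_strict_left_mono)
  have upper: "lam y < lam x" if "r_const \<le> x" "x < y" for x y
  proof -
    have "0 < (y - x) * (x + y - 1)" using that r_const_bounds by (intro mult_pos_pos) auto
    then show ?thesis using that by (simp add: lam_upper field_simps)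
  qed
  have "lam y < lam x" if "0 \<le> x" "x < y" "y \<le> r_const" for x y
    using lower[of x y] middle[of x y] lower[of x l_const] middle[of l_const y] that l_less_r
    by (cases "x < l_const"; cases "l_const < y") (auto simp: not_less)
  then show ?thesis
    using upper[of x y] upper[of r_const y] assms r_const_bounds
    by (cases "x < r_const"; cases "r_const < y") (force simp: not_less)+
qed

lemma lam_bounds: assumes "x \<in> {0..1}" shows "0 \<le> lam x" "lam x \<le> 1"
  using lam_strict_antimono[of x 1] lam_strict_antimono[of 0 x] assms
  by (cases "x = 1"; cases "x = 0"; force)+

lemma mult_in_unit: "x \<in> {0..1} \<Longrightarrow> y \<in> {0..1} \<Longrightarrow> x * y \<in> {0..1::real}"
  by (auto simp: mult_le_one)

lemma x_lam_middle: "l_const \<le> x \<Longrightarrow> x \<le> r_const \<Longrightarrow> x * lam x = l_const * r_const^2"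
  using l_const_bounds by (simp add: lam_middle)

text \<open>This exchanges the lower and upper branches of \<open>lam\<close>, so that questions
  about \<open>x * lam x\<close> outside the middle interval reduce to
  \<open>[0, l]\<close>.\<close>

lemma x_lam_reflect:
  assumes "t \<le> l_const"
  shows "lam (1 - 2 * t) = t * (1 - 2 * t)" "(1 - 2 * t) * lam (1 - 2 * t) = t * lam t"
  using assms by (auto simp: lam_upper lam_lower r_const_def power2_eq_square)

text \<open>The difference factors as \<open>(t - s) * (u^2 - 4 * s * t)\<close>, and
  \<open>l_const < 1/10\<close> gives \<open>u \<ge> 6/10\<close>. With \<open>t = l_const\<close>
  it separates the outer values of \<open>x * lam x\<close> from the constant middle one.\<close>

lemma x_lam_strict_mono:
  assumes "0 \<le> s" "s < t" "t \<le> l_const"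
  shows "s * lam s < t * lam t"
proof -
  define u where "u = 1 - 2 * t - 2 * s"
  have "0 < (t - s) * (u^2 - 4 * s * t)"
  proof (intro mult_pos_pos)
    have "2 * s * (2 * t) \<le> (2/10) * (2/10)" using assms l_const_bounds by (intro mult_mono) auto
    moreover have "(6/10)^2 \<le> u^2" using assms l_const_bounds by (intro power_mono) (auto simp: u_def)
    ultimately show "0 < u^2 - 4 * s * t" by (simp add: power2_eq_square)
  qed (use assms in auto)
  also have "(t - s) * (u^2 - 4 * s * t) = t * (1 - 2 * t)^2 - s * (1 - 2 * s)^2"
    by (simp add: u_def algebra_simps power2_eq_square)
  finally show ?thesis using assms by (simp add: lam_lower)
qed

section \<open>The contact set\<close>

definition contact :: "real \<Rightarrow> real \<Rightarrow> real \<Rightarrow> bool" where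
  "contact x y z \<longleftrightarrow> {x, y, z} \<subseteq> {0..1} \<and> y * z = lam x \<and> x * z = lam y \<and> x * y = lam z"

lemma contact_middle:
  assumes "{x, y, z} \<subseteq> {l_const..r_const}" "x * y * z = l_const * r_const^2"
  shows "contact x y z"
proof -
  have "{x, y, z} \<subseteq> {0..1}" "0 < x" "0 < y" "0 < z"
    using assms(1) l_const_bounds r_const_bounds by auto
  moreover have "lam x = l_const * r_const^2 / x" "lam y = l_const * r_const^2 / y" "lam z = l_const * r_const^2 / z"
    using assms(1) by (auto intro!: lam_middle)
  ultimately show ?thesis
    unfolding contact_def assms(2) [symmetric] by simp
qed

lemma contact_outer:
  assumes "0 \<le> t" "t \<le> l_const"
  shows "contact t (1 - 2 * t) (1 - 2 * t)"
  using assms l_const_bounds x_lam_reflect[of t]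
  by (auto simp: contact_def lam_lower power2_eq_square)

text \<open>Every coordinate \<open>v\<close> of a contact point satisfies
  \<open>v * lam v = x * y * z\<close>. By strict monotonicity and reflection, either all
  coordinates lie in \<open>[l, r]\<close>, or all are \<open>t\<close> or \<open>1 - 2 * t\<close>
  for one common \<open>t\<close>.\<close>

lemma contact_cases:
  assumes "contact x y z"
  obtains "{x, y, z} \<subseteq> {l_const..r_const}" "x * y * z = l_const * r_const^2"
  | t where "0 \<le> t" "t \<le> l_const"
      "(x, y, z) \<in> {(t, 1 - 2 * t, 1 - 2 * t), (1 - 2 * t, t, 1 - 2 * t), (1 - 2 * t, 1 - 2 * t, t)}"
proof -
  have xyz: "{x, y, z} \<subseteq> {0..1}" and eqs: "y * z = lam x" "x * z = lam y" "x * y = lam z"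
    using assms by (auto simp: contact_def)
  have T: "v * lam v = x * y * z" if "v \<in> {x, y, z}" for v
    using that by (elim insertE emptyE) (simp_all flip: eqs add: mult_ac)
  have reduce: "\<exists>s. 0 \<le> s \<and> s < l_const \<and> s * lam s = v * lam v \<and> (v = s \<or> v = 1 - 2 * s)"
    if "v \<in> {0..1}" "v \<notin> {l_const..r_const}" for v
  proof (cases "v < l_const")
    case True
    with that show ?thesis by (intro exI[of _ v]) auto
  next
    case False
    define s where "s = (1 - v)/2"
    have v: "v = 1 - 2 * s" by (simp add: s_def field_simps)
    have "0 \<le> s" "s < l_const" using False that by (auto simp: r_const_def s_def)
    with x_lam_reflect(2)[of s] show ?thesis unfolding v by (intro exI[of _ s]) auto
  qed
  consider (zero) "0 \<in> {x, y, z}" | (mid) "\<exists>v\<in>{x, y, z}. v \<in> {l_const..r_const}"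
    | (outer) "0 \<notin> {x, y, z}" "\<forall>v\<in>{x, y, z}. v \<notin> {l_const..r_const}" by blast
  then show thesis
  proof cases
    \<comment> \<open>For \<open>t = 0\<close> the product says nothing about how often
      \<open>t\<close> occurs; \<open>lam 0 = 1\<close> does.\<close>
    case zero
    have one: "a = 1 \<and> b = 1" if "a * b = lam 0" "a \<in> {0..1}" "b \<in> {0..1}" for a b
      using that mult_left_le[of b a] mult_left_le[of a b] by (auto simp: mult.commute)
    from zero consider "x = 0" | "y = 0" | "z = 0" by blast
    then have "(x, y, z) \<in> {(0, 1, 1), (1, 0, 1), (1, 1, 0)}"
    proof cases
      case 1
      then show ?thesis using one[of y z] eqs(1) xyz by simp
    next
      case 2
      then show ?thesis using one[of x z] eqs(2) xyz by simp
    next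
      case 3
      then show ?thesis using one[of x y] eqs(3) xyz by simp
    qed
    then show thesis using l_const_bounds by (intro that(2)[of 0]) auto
  next
    case mid
    from mid obtain v where v: "v \<in> {x, y, z}" "v \<in> {l_const..r_const}" by blast
    then have p: "x * y * z = l_const * r_const^2"
      unfolding T[OF v(1), symmetric] by (intro x_lam_middle) auto
    have "v \<in> {l_const..r_const}" if v: "v \<in> {x, y, z}" for v
    proof (rule ccontr)
      assume *: "v \<notin> {l_const..r_const}"
      from v xyz have "v \<in> {0..1}" by blast
      from reduce[OF this *] obtain t where t: "0 \<le> t" "t < l_const" "t * lam t = v * lam v" by blast
      from x_lam_strict_mono[OF t(1,2)] t(3) x_lam_middle[of l_const] l_less_r T[OF v] p
      show False by simp
    qed
    with p show thesis by (intro that(1)) auto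
  next
    case outer
    have "\<exists>s. 0 \<le> s \<and> s < l_const \<and> s * lam s = x * y * z \<and> (v = s \<or> v = 1 - 2 * s)"
      if v: "v \<in> {x, y, z}" for v
      using reduce[of v] outer(2) v xyz T[OF v] by (metis subsetD)
    then obtain s where S: "0 \<le> s v" "s v < l_const" "s v * lam (s v) = x * y * z"
        "v = s v \<or> v = 1 - 2 * s v" if "v \<in> {x, y, z}" for v
      by metis
    define t where "t = s x"
    have t: "0 \<le> t" "t < l_const" "t * lam t = x * y * z" unfolding t_def using S(1-3)[of x] by blast+
    have st: "v = t \<or> v = 1 - 2 * t" if v: "v \<in> {x, y, z}" for v
    proof -
      have "s v = t"
        using S(1-3)[OF v] t x_lam_strict_mono[of "s v" t] x_lam_strict_mono[of t "s v"]
        by (metis less_imp_le less_irrefl linorder_neqE_linordered_idom)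
      then show ?thesis using S(4)[OF v] by simp
    qed
    have "t \<noteq> 0" using t(3) outer(1) by auto
    then have t0: "0 < t" using t by simp
    define u where "u = 1 - 2 * t"
    have u: "t < u" using t l_const_bounds by (auto simp: u_def)
    have p: "x * y * z = t * u * u" using t by (simp add: lam_lower u_def power2_eq_square)
    have v: "x = t \<or> x = u" "y = t \<or> y = u" "z = t \<or> z = u" using st by (auto simp: u_def)
    \<comment> \<open>Because \<open>0 < t < u\<close>, none of \<open>t^3\<close>,
      \<open>t^2 * u\<close> and \<open>u^3\<close> equals \<open>t * u^2\<close>, so
      \<open>t\<close> occurs exactly once.\<close>
    have "(x, y, z) \<in> {(t, u, u), (u, t, u), (u, u, t)}"
      using v p u t0 mult_strict_mono[of t u t u] by (elim disjE) auto
    then show thesis using t by (intro that(2)[of t]) (auto simp: u_def)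
  qed
qed

subsection \<open>Integration over the contact set and conjugation\<close>

lemma contact_rotate: "contact x y z \<Longrightarrow> contact y z x"
  by (auto simp: contact_def mult.commute)

lemma has_integral_reflect_double:
  fixes k :: "real \<Rightarrow> real"
  assumes "(k has_integral i) {1 - 2 * a..1}"
  shows "((\<lambda>t. 2 * k (1 - 2 * t)) has_integral i) {0..a}"
proof -
  have "((\<lambda>x. k (- x)) has_integral i) (cbox (- 1) (- (1 - 2 * a)))"
    using has_integral_reflect_lemma_real[OF assms] by simp
  from has_integral_affinity'[OF this, of 2 "- 1"]
  have "((\<lambda>t. k (- (2 * t + - 1))) has_integral i / 2) (cbox ((- 1 - - 1) /\<^sub>R 2) ((- (1 - 2 * a) - - 1) /\<^sub>R 2))"
    by simp
  from has_integral_mult_right[OF this, of 2] show ?thesis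
    by simp
qed

lemma contact_integral_nonpos:
  fixes \<phi> :: "real \<Rightarrow> real"
  assumes cont: "continuous_on {0..1} \<phi>"
    and le: "\<And>x y z. contact x y z \<Longrightarrow> \<phi> x + \<phi> y + \<phi> z \<le> 0"
  shows "integral {0..1} \<phi> \<le> 0"
proof -
  let ?l = l_const and ?r = r_const
  note lr = l_const_bounds r_const_bounds l_less_r
  have cont_sub: "continuous_on {a..b} \<phi>" if "0 \<le> a" "b \<le> 1" for a b
    using cont by (rule continuous_on_subset) (use that in auto)
  have int: "(\<phi> has_integral integral {a..b} \<phi>) {a..b}" if "0 \<le> a" "b \<le> 1" for a b
    by (rule integrable_integral[OF integrable_continuous_real[OF cont_sub[OF that]]])
  have split: "integral {0..1} \<phi> = integral {0..?l} \<phi> + integral {?l..?r} \<phi> + integral {?r..1} \<phi>"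
    using lr Henstock_Kurzweil_Integration.integral_combine[where a = 0 and c = ?l and b = 1 and f = \<phi>]
      Henstock_Kurzweil_Integration.integral_combine[where a = ?l and c = ?r and b = 1 and f = \<phi>]
      integrable_continuous_real[OF cont_sub] by simp
  have "integral {0..?l} \<phi> + integral {?r..1} \<phi> \<le> 0"
  proof -
    \<comment> \<open>The Jacobian 2 of \<open>t \<mapsto> 1 - 2 * t\<close> matches the two
      coordinates \<open>1 - 2 * t\<close> of an outer contact point, so Lebesgue measure results on
      both outer intervals.\<close>
    have "((\<lambda>t. 2 * \<phi> (1 - 2 * t)) has_integral integral {?r..1} \<phi>) {0..?l}"
      using int[of ?r 1] lr unfolding r_const_def by (intro has_integral_reflect_double) auto
    from has_integral_add[OF int[of 0 ?l] this]
    have "((\<lambda>t. \<phi> t + 2 * \<phi> (1 - 2 * t)) has_integral integral {0..?l} \<phi> + integral {?r..1} \<phi>) {0..?l}"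
      using lr by simp
    then show ?thesis
    proof (rule has_integral_nonpos)
      fix t assume "t \<in> {0..?l}"
      then show "\<phi> t + 2 * \<phi> (1 - 2 * t) \<le> 0"
        using le[OF contact_outer[of t]] by simp
    qed
  qed
  moreover have "integral {?l..?r} \<phi> \<le> 0"
  proof -
    \<comment> \<open>This is \<open>ln (r_const / l_const)\<close> by the root equation. Together
      with \<open>r_const = 1 - 2 * l_const\<close> it yields the mean condition of
      \<open>mixing_inequality\<close>.\<close>
    define L where "L = 3 - 9 * ?l"
    have L: "21/10 \<le> L" "L \<le> 11/5" using lr by (auto simp: L_def)
    have expL: "exp L = ?r / ?l" unfolding L_def by (rule exp_l_const)
    then have r: "?l * exp L = ?r" using lr by simp
    have "exp L * (3 - L) = 3 + 2 * L"
      unfolding expL using lr by (simp add: L_def r_const_def)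
    define \<psi> where "\<psi> p = \<phi> (?l * exp (L - p))" for p
    have range: "?l * exp p \<in> {?l..?r}" if "p \<in> {0..L}" for p
      using that lr by (simp flip: r)
    have "integral {0..L} (\<lambda>p. exp (- p) * \<psi> p) \<le> 0"
    proof (rule mixing_inequality[OF L])
      show "exp L * (3 - L) = 3 + 2 * L" by fact
      show "continuous_on {0..L} \<psi>"
        unfolding \<psi>_def
      proof (rule continuous_on_compose2[OF cont_sub[of ?l ?r]])
        show "(\<lambda>p. ?l * exp (L - p)) ` {0..L} \<subseteq> {?l..?r}"
          by (intro image_subsetI range) auto
      qed (use lr in \<open>auto intro!: continuous_intros\<close>)
      fix p q s :: real assume "0 \<le> p" "0 \<le> q" "0 \<le> s" and sum: "p + q + s = L"
      have "?l * exp (L - p) * (?l * exp (L - q)) * (?l * exp (L - s)) = ?l ^ 3 * exp ((L - p) + (L - q) + (L - s))"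
        unfolding exp_add by (simp add: power3_eq_cube)
      also have "(L - p) + (L - q) + (L - s) = L + L" using sum by simp
      also have "?l ^ 3 * exp (L + L) = ?l * ?r^2"
        unfolding exp_add by (simp add: power3_eq_cube power2_eq_square flip: r)
      finally have prod: "?l * exp (L - p) * (?l * exp (L - q)) * (?l * exp (L - s)) = ?l * ?r^2" .
      have "{?l * exp (L - p), ?l * exp (L - q), ?l * exp (L - s)} \<subseteq> {?l..?r}"
        using \<open>0 \<le> p\<close> \<open>0 \<le> q\<close> \<open>0 \<le> s\<close> sum range[of "L - p"] range[of "L - q"] range[of "L - s"] by simp
      from le[OF contact_middle[OF this prod]] show "\<psi> p + \<psi> q + \<psi> s \<le> 0"
        by (simp add: \<psi>_def)
    qed
    moreover have "((\<lambda>u. (?l * exp u) *\<^sub>R \<phi> (?l * exp u)) has_integral integral {?l * exp 0..?l * exp L} \<phi>) {0..L}"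
    proof (rule has_integral_substitution)
      show "(\<lambda>u. ?l * exp u) ` {0..L} \<subseteq> {?l..?r}"
        by (intro image_subsetI range)
      show "continuous_on {?l..?r} \<phi>" using lr by (intro cont_sub) auto
    qed (use L lr in \<open>auto intro!: derivative_eq_intros\<close>)
    then have "((\<lambda>u. ?l * exp u * \<phi> (?l * exp u)) has_integral integral {?l..?r} \<phi>) {0..L}"
      by (simp add: r)
    from has_integral_reflect_interval[OF this]
    have "((\<lambda>p. ?r * (exp (- p) * \<psi> p)) has_integral integral {?l..?r} \<phi>) {0..L}"
      by (simp add: \<psi>_def exp_diff exp_minus divide_inverse mult.assoc flip: r)
    from integral_unique[OF this]
    have "integral {?l..?r} \<phi> = ?r * integral {0..L} (\<lambda>p. exp (- p) * \<psi> p)" by simp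
    ultimately show ?thesis using lr by (simp add: mult_nonneg_nonpos)
  qed
  ultimately show ?thesis unfolding split by linarith
qed

text \<open>\<open>F x\<close> is the infimum of \<open>C (x * y * z) - g y - h z\<close> over
  \<open>y\<close> and \<open>z\<close>, bounded below by \<open>f x\<close>. It inherits continuity
  from the uniform continuity of \<open>C\<close>, because \<open>y * z \<le> 1\<close> keeps
  arguments at least as close as the points \<open>x\<close>; nothing is assumed about the
  regularity of \<open>f\<close>, \<open>g\<close>, \<open>h\<close>.\<close>

lemma conjugate_exists:
  fixes C f g h :: "real \<Rightarrow> real"
  assumes cont: "continuous_on {0..1} C"
    and le: "\<And>x y z. x \<in> {0..1} \<Longrightarrow> y \<in> {0..1} \<Longrightarrow> z \<in> {0..1} \<Longrightarrow> f x + g y + h z \<le> C (x * y * z)"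
  obtains F where "continuous_on {0..1} F" "\<And>x. x \<in> {0..1} \<Longrightarrow> f x \<le> F x"
    "\<And>x y z. x \<in> {0..1} \<Longrightarrow> y \<in> {0..1} \<Longrightarrow> z \<in> {0..1} \<Longrightarrow> F x + g y + h z \<le> C (x * y * z)"
proof -
  let ?S = "{0..1::real} \<times> {0..1::real}"
  define s where "s x = (\<lambda>(y, z). C (x * y * z) - g y - h z)" for x
  define F where "F x = Inf (s x ` ?S)" for x
  have lower: "f x \<le> s x p" if "x \<in> {0..1}" "p \<in> ?S" for x p
    using le[of x "fst p" "snd p"] that by (auto simp: s_def)
  have F_le: "F x \<le> s x p" if "x \<in> {0..1}" "p \<in> ?S" for x p
    unfolding F_def using lower[OF that(1)] that(2) by (intro cINF_lower bdd_belowI2[where m = "f x"])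
  have le_F: "a \<le> F x" if "\<And>p. p \<in> ?S \<Longrightarrow> a \<le> s x p" for a x
    unfolding F_def using that by (intro cINF_greatest) auto
  have "continuous_on {0..1} F"
    unfolding continuous_on_iff
  proof (intro ballI allI impI)
    fix x e :: real assume x: "x \<in> {0..1}" and "0 < e"
    have "uniformly_continuous_on {0..1} C"
      using cont by (rule compact_uniformly_continuous) simp
    then obtain d where d: "0 < d"
      "\<And>u v. u \<in> {0..1} \<Longrightarrow> v \<in> {0..1} \<Longrightarrow> dist v u < d \<Longrightarrow> dist (C v) (C u) < e/2"
      unfolding uniformly_continuous_on_def using \<open>0 < e\<close> half_gt_zero by metis
    have half: "F v \<le> F u + e/2" if u: "u \<in> {0..1}" and v: "v \<in> {0..1}" and uv: "dist v u < d" for u v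
    proof -
      have "F v - e/2 \<le> F u"
      proof (rule le_F)
        fix p assume p: "p \<in> ?S"
        obtain y z where yz: "p = (y, z)" "y \<in> {0..1}" "z \<in> {0..1}" using p by auto
        have "\<bar>v - u\<bar> * (y * z) \<le> \<bar>v - u\<bar> * 1"
          using mult_in_unit[OF yz(2,3)] by (intro mult_left_mono) auto
        moreover have "\<bar>v * y * z - u * y * z\<bar> = \<bar>v - u\<bar> * (y * z)"
          using yz by (simp add: mult.assoc abs_mult flip: left_diff_distrib)
        ultimately have "dist (v * y * z) (u * y * z) < d"
          using uv by (simp add: dist_real_def)
        then have "dist (C (v * y * z)) (C (u * y * z)) < e/2"
          using u v yz by (intro d mult_in_unit)
        then have "s v p < s u p + e/2" by (auto simp: s_def yz(1) dist_real_def abs_if split: if_splits)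
        with F_le[OF v p] show "F v - e/2 \<le> s u p" by simp
      qed
      then show ?thesis by simp
    qed
    have "dist (F u) (F x) < e" if u: "u \<in> {0..1}" "dist u x < d" for u
      using half[OF x u] half[OF u(1) x] u(2) \<open>0 < e\<close> by (simp add: dist_commute) (simp add: dist_real_def)
    with d(1) show "\<exists>d>0. \<forall>u\<in>{0..1}. dist u x < d \<longrightarrow> dist (F u) (F x) < e" by blast
  qed
  moreover have "f x \<le> F x" if "x \<in> {0..1}" for x
    using that by (intro le_F lower)
  moreover have "F x + g y + h z \<le> C (x * y * z)" if "x \<in> {0..1}" "y \<in> {0..1}" "z \<in> {0..1}" for x y z
    using F_le[of x "(y, z)"] that by (auto simp: s_def)
  ultimately show thesis by (rule that)
qed

lemma chain_unit:
  assumes "(f has_real_derivative d) (at (g x) within {0..1})" "g ` S \<subseteq> {0..1}"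
    "(g has_real_derivative e) (at x within S)"
  shows "((\<lambda>x. f (g x)) has_real_derivative d * e) (at x within S)"
  using DERIV_image_chain[OF has_field_derivative_subset[OF assms(1,2)] assms(3)] by (simp add: o_def)

text \<open>Completeness of Lebesgue measure absorbs the null set. In the converse direction of the
  theorem the functions are known only almost everywhere, and their integrability has to be
  derived.\<close>

lemma borel_measurable_unit_AE:
  fixes f g :: "real \<Rightarrow> real"
  assumes g: "g \<in> borel_measurable (lebesgue_on {0..1})"
    and AE: "AE x in lebesgue_on {0..1}. f x = g x"
  shows "f \<in> borel_measurable (lebesgue_on {0..1})"
proof -
  interpret complete_measure "lebesgue_on {0..1::real}"
  proof (rule complete_measure.intro)
    fix A B :: "real set"
    assume *: "B \<subseteq> A" "A \<in> null_sets (lebesgue_on {0..1})"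
    then have "A \<subseteq> {0..1}" "A \<in> null_sets lebesgue"
      by (simp_all add: null_sets_restrict_space)
    with * show "B \<in> sets (lebesgue_on {0..1})"
      using completion.complete[of B A lborel] by (simp add: sets_restrict_space_iff)
  qed
  show ?thesis
  proof (rule measurableI)
    fix A :: "real set" assume A: "A \<in> sets borel"
    show "f -` A \<inter> space (lebesgue_on {0..1}) \<in> sets (lebesgue_on {0..1})"
    proof (rule in_sets_AE)
      show "g -` A \<inter> space (lebesgue_on {0..1}) \<in> sets (lebesgue_on {0..1})"
        using g A by (rule measurable_sets)
      show "AE x in lebesgue_on {0..1}. x \<in> g -` A \<inter> space (lebesgue_on {0..1})
          \<longleftrightarrow> x \<in> f -` A \<inter> space (lebesgue_on {0..1})"
        using AE by eventually_elim auto
    qed auto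
  qed simp
qed

subsection \<open>The dual problem\<close>

locale increasing_cost =
  fixes C D :: "real \<Rightarrow> real"
  assumes deriv: "\<And>t. t \<in> {0..1} \<Longrightarrow> (C has_real_derivative D t) (at t within {0..1})"
    and cont: "continuous_on {0..1} D"
    and mono: "strict_mono_on {0..1} (\<lambda>t. t * D t)"
begin

abbreviation "F \<equiv> lam_potential D"
abbreviation "K \<equiv> C 0 - 2 * F 1"

section \<open>The potential: derivative, values at contact points, feasibility\<close>

lemma C_cont: "continuous_on {0..1} C"
  by (rule DERIV_continuous_on) (rule deriv)

lemma scaled_deriv:
  assumes "w \<in> {0..1}" "x \<in> {0..1}"
  shows "((\<lambda>x. C (x * w)) has_real_derivative D (x * w) * w) (at x within {0..1})"
  using assms by (intro chain_unit deriv mult_in_unit) (auto simp: mult_le_one intro!: derivative_eq_intros)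

lemma potential_kernel_cont: "continuous_on {0..1} (\<lambda>t. lam t * D (t * lam t))"
proof -
  have "continuous_on {0..1} (\<lambda>t. D (t * lam t))"
    by (rule continuous_on_compose2[OF cont])
      (auto intro!: continuous_intros continuous_on_lam mult_le_one lam_bounds mult_nonneg_nonneg)
  then show ?thesis by (intro continuous_intros continuous_on_lam)
qed

lemma F_deriv:
  assumes x: "x \<in> {0..1}"
  shows "(F has_real_derivative lam x * D (x * lam x)) (at x within {0..1})"
proof (rule has_field_derivative_transform_within[OF integral_has_real_derivative[OF potential_kernel_cont x] zero_less_one x])
  fix u :: real assume "u \<in> {0..1}"
  then have "continuous_on {0..u} (\<lambda>t. lam t * D (t * lam t))"
    by (intro continuous_on_subset[OF potential_kernel_cont]) auto
  then show "integral {0..u} (\<lambda>t. lam t * D (t * lam t)) = F u"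
    unfolding lam_potential_def
    by (intro lebesgue_integral_eq_integral [symmetric] continuous_imp_integrable_real) auto
qed

lemma F_cont: "continuous_on {0..1} F"
  by (rule DERIV_continuous_on) (rule F_deriv)

lemma F_0: "F 0 = 0"
proof -
  have "F 0 = integral {0..0} (\<lambda>t. lam t * D (t * lam t))"
    unfolding lam_potential_def
    by (intro lebesgue_integral_eq_integral continuous_imp_integrable_real) auto
  then show ?thesis by simp
qed

text \<open>Along the curve \<open>(t, 1 - 2 * t, 1 - 2 * t)\<close> all occurrences of
  \<open>D\<close> have the same argument, by \<open>x_lam_reflect\<close>, and their coefficients
  cancel. At \<open>t = 0\<close> the identity is the choice of \<open>K\<close>.\<close>

lemma outer_value:
  assumes "0 \<le> t" "t \<le> l_const"
  shows "F t + 2 * F (1 - 2 * t) + K = C (t * (1 - 2 * t)^2)"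
proof -
  define G where "G t = F t + 2 * F (1 - 2 * t) - C (t * (1 - 2 * t)^2)" for t
  have "\<exists>c. \<forall>t\<in>{0..l_const}. G t = c"
  proof (rule has_field_derivative_zero_constant)
    fix t assume t: "t \<in> {0..l_const}"
    have sub: "{0..l_const} \<subseteq> {0..1}" using l_const_bounds by auto
    have t1: "t \<in> {0..1}" "1 - 2 * t \<in> {0..1}" using t l_const_bounds by auto
    have m: "s * (1 - 2 * s)^2 \<in> {0..1}" if "s \<in> {0..l_const}" for s
      unfolding power2_eq_square using that l_const_bounds by (intro mult_in_unit) auto
    have 1: "(F has_real_derivative lam t * D (t * lam t)) (at t within {0..l_const})"
      by (rule has_field_derivative_subset[OF F_deriv[OF t1(1)] sub])
    have "((\<lambda>t. 1 - 2 * t) has_real_derivative -2) (at t within {0..l_const})"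
      by (auto intro!: derivative_eq_intros)
    moreover have "(\<lambda>t. 1 - 2 * t) ` {0..l_const} \<subseteq> {0..1}" using l_const_bounds by auto
    ultimately have 2: "((\<lambda>t. F (1 - 2 * t)) has_real_derivative lam (1 - 2 * t) * D ((1 - 2 * t) * lam (1 - 2 * t)) * -2)
        (at t within {0..l_const})"
      by (intro chain_unit F_deriv t1)
    have "((\<lambda>t. t * (1 - 2 * t)^2) has_real_derivative (1 - 2 * t)^2 - 4 * t * (1 - 2 * t)) (at t within {0..l_const})"
      by (auto intro!: derivative_eq_intros simp: algebra_simps power2_eq_square)
    from chain_unit[OF deriv[OF m[OF t]] _ this]
    have 3: "((\<lambda>t. C (t * (1 - 2 * t)^2)) has_real_derivative D (t * (1 - 2 * t)^2) * ((1 - 2 * t)^2 - 4 * t * (1 - 2 * t)))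
        (at t within {0..l_const})"
      using m by blast
    have l: "lam t = (1 - 2 * t)^2" using t by (simp add: lam_lower)
    have e: "(1 - 2 * t) * lam (1 - 2 * t) = t * (1 - 2 * t)^2" "lam (1 - 2 * t) = t * (1 - 2 * t)"
      using x_lam_reflect[of t] t by (simp_all add: l)
    have "(G has_real_derivative lam t * D (t * lam t) + 2 * (lam (1 - 2 * t) * D ((1 - 2 * t) * lam (1 - 2 * t)) * -2)
        - D (t * (1 - 2 * t)^2) * ((1 - 2 * t)^2 - 4 * t * (1 - 2 * t))) (at t within {0..l_const})"
      unfolding G_def by (intro DERIV_diff DERIV_add DERIV_cmult 1 2 3)
    also have "lam t * D (t * lam t) + 2 * (lam (1 - 2 * t) * D ((1 - 2 * t) * lam (1 - 2 * t)) * -2)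
        - D (t * (1 - 2 * t)^2) * ((1 - 2 * t)^2 - 4 * t * (1 - 2 * t)) = 0"
      unfolding e(1) unfolding e(2) l by (simp add: left_diff_distrib right_diff_distrib)
    finally show "(G has_real_derivative 0) (at t within {0..l_const})" .
  qed simp
  then have "G t = G 0" using assms by auto
  then show ?thesis by (simp add: G_def F_0)
qed

text \<open>On the middle interval \<open>x * lam x\<close> is constant, so the derivative of
  \<open>F\<close> is a multiple of \<open>1 / x\<close>.\<close>

lemma middle_value:
  assumes "x \<in> {l_const..r_const}"
  shows "F x = F l_const + l_const * r_const^2 * D (l_const * r_const^2) * (ln x - ln l_const)"
proof -
  define G where "G x = F x - l_const * r_const^2 * D (l_const * r_const^2) * ln x" for x
  have "\<exists>c. \<forall>x\<in>{l_const..r_const}. G x = c"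
  proof (rule has_field_derivative_zero_constant)
    fix x assume x: "x \<in> {l_const..r_const}"
    have sub: "{l_const..r_const} \<subseteq> {0..1}" and x0: "0 < x" 
      using x l_const_bounds r_const_bounds by auto
    have 1: "(F has_real_derivative lam x * D (x * lam x)) (at x within {l_const..r_const})"
      using x sub by (intro has_field_derivative_subset[OF F_deriv sub]) auto
    have 2: "(ln has_real_derivative 1 / x) (at x within {l_const..r_const})"
      using x0 by (auto intro!: derivative_eq_intros simp: divide_inverse)
    have "(G has_real_derivative lam x * D (x * lam x) - l_const * r_const^2 * D (l_const * r_const^2) * (1 / x))
        (at x within {l_const..r_const})"
      unfolding G_def by (intro DERIV_diff DERIV_cmult 1 2)
    then show "(G has_real_derivative 0) (at x within {l_const..r_const})"
      using x x_lam_middle[of x] by (simp add: lam_middle)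
  qed simp
  then have "G x = G l_const" using assms by auto
  then show ?thesis by (simp add: G_def algebra_simps)
qed

text \<open>In the middle case the logarithms combine to a function of \<open>x * y * z\<close>
  alone, so the sum equals that at \<open>(l, r, r)\<close>, which is also the outer contact point
  for \<open>t = l\<close>.\<close>

lemma contact_value:
  assumes "contact x y z"
  shows "F x + F y + F z + K = C (x * y * z)"
  using assms
proof (cases rule: contact_cases)
  case 1
  define m where "m = l_const * r_const^2 * D (l_const * r_const^2)"
  have pos: "0 < x" "0 < y" "0 < z" "0 < l_const" "0 < r_const"
    using 1(1) l_const_bounds r_const_bounds by auto
  have "F x + F y + F z = 3 * F l_const + m * (ln (x * y * z) - 3 * ln l_const)"
    using 1(1) pos by (simp add: middle_value[of x] middle_value[of y] middle_value[of z] m_def ln_mult algebra_simps)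
  also have "ln (x * y * z) = ln l_const + 2 * ln r_const"
    unfolding 1(2) using pos by (simp add: ln_mult ln_realpow)
  also have "3 * F l_const + m * (ln l_const + 2 * ln r_const - 3 * ln l_const) = F l_const + 2 * F r_const"
    using middle_value[of r_const] l_less_r by (simp add: m_def algebra_simps)
  finally show ?thesis
    using outer_value[of l_const] l_const_bounds by (simp add: 1(2) r_const_def)
next
  case (2 t)
  then show ?thesis
    using outer_value[of t] by (auto simp: power2_eq_square mult_ac)
qed

text \<open>Multiplied by \<open>u\<close>, the derivative of \<open>C (u * w) - F u\<close> is the
  difference of the values of \<open>s * D s\<close> at \<open>u * w\<close> and
  \<open>u * lam u\<close>. Hence it has the sign of \<open>w - lam u\<close> for
  \<open>u > 0\<close>. As \<open>lam\<close> decreases, moving from \<open>x\<close> towards the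
  point \<open>v\<close> with \<open>lam v = w\<close> strictly lowers the value.\<close>

lemma minimizer_lam:
  assumes x: "x \<in> {0..1}" and w: "w \<in> {0..1}"
    and min: "\<And>u. u \<in> {0..1} \<Longrightarrow> C (x * w) - F x \<le> C (u * w) - F u"
  shows "w = lam x"
proof -
  define g' where "g' u = D (u * w) * w - lam u * D (u * lam u)" for u
  have d: "((\<lambda>u. C (u * w) - F u) has_derivative (*) (g' u)) (at u within {a..b})"
    if "0 \<le> a" "b \<le> 1" "a \<le> u" "u \<le> b" for a b u
  proof -
    have "((\<lambda>u. C (u * w) - F u) has_real_derivative g' u) (at u within {0..1})"
      unfolding g'_def using that by (intro DERIV_diff scaled_deriv F_deriv w) auto
    then have "((\<lambda>u. C (u * w) - F u) has_real_derivative g' u) (at u within {a..b})"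
      by (rule has_field_derivative_subset) (use that in auto)
    then show ?thesis by (simp add: has_field_derivative_def)
  qed
  have sign: "(w < lam u \<longrightarrow> g' u < 0) \<and> (lam u < w \<longrightarrow> 0 < g' u)" if u: "0 < u" "u \<le> 1" for u
  proof -
    have u1: "u * w \<in> {0..1}" "u * lam u \<in> {0..1}"
      using u w by (auto intro!: mult_in_unit mult_le_one lam_bounds mult_nonneg_nonneg)
    have "u * g' u = u * w * D (u * w) - u * lam u * D (u * lam u)"
      by (simp add: g'_def algebra_simps)
    moreover have "u * w * D (u * w) < u * lam u * D (u * lam u)" if "w < lam u"
      using strict_mono_onD[OF mono u1] that u by simp
    moreover have "u * lam u * D (u * lam u) < u * w * D (u * w)" if "lam u < w"
      using strict_mono_onD[OF mono u1(2,1)] that u by simp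
    ultimately have "(w < lam u \<longrightarrow> u * g' u < 0) \<and> (lam u < w \<longrightarrow> 0 < u * g' u)" by simp
    with u show ?thesis by (simp add: mult_less_0_iff zero_less_mult_iff)
  qed
  have cont_sub: "continuous_on {a..b} lam" if "0 \<le> a" "b \<le> 1" for a b
    using continuous_on_lam by (rule continuous_on_subset) (use that in auto)
  have "\<not> w < lam x"
  proof
    assume "w < lam x"
    with IVT2'[of lam 1 w x] x w cont_sub[of x 1]
    obtain v where v: "x \<le> v" "v \<le> 1" "lam v = w" by auto
    with \<open>w < lam x\<close> have "x < v" by (cases "x = v") auto
    from mvt_simple[OF this, of "\<lambda>u. C (u * w) - F u" "\<lambda>u. (*) (g' u)"] d[of x v] x v
    obtain u where u: "x < u" "u < v" "(C (v * w) - F v) - (C (x * w) - F x) = g' u * (v - x)"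
      by auto
    have "w < lam u" using lam_strict_antimono[of u v] u v x by auto
    then have "g' u < 0" using sign[of u] u v x by auto
    then have "g' u * (v - x) < 0" using \<open>x < v\<close> by (simp add: mult_neg_pos)
    with min[of v] u v x show False by auto
  qed
  moreover have "\<not> lam x < w"
  proof
    assume "lam x < w"
    with IVT2'[of lam x w 0] x w cont_sub[of 0 x]
    obtain v where v: "0 \<le> v" "v \<le> x" "lam v = w" by auto
    with \<open>lam x < w\<close> have "v < x" by (cases "x = v") auto
    from mvt_simple[OF this, of "\<lambda>u. C (u * w) - F u" "\<lambda>u. (*) (g' u)"] d[of v x] x v
    obtain u where u: "v < u" "u < x" "(C (x * w) - F x) - (C (v * w) - F v) = g' u * (x - v)"
      by auto
    have "lam u < w" using lam_strict_antimono[of v u] u v x by auto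
    then have "0 < g' u" using sign[of u] u v x by auto
    then have "0 < g' u * (x - v)" using \<open>v < x\<close> by simp
    with min[of v] u v x show False by auto
  qed
  ultimately show ?thesis by simp
qed

lemma potential_feasible:
  assumes "x \<in> {0..1}" "y \<in> {0..1}" "z \<in> {0..1}"
  shows "F x + F y + F z + K \<le> C (x * y * z)"
proof -
  let ?Q = "{0..1::real} \<times> {0..1::real} \<times> {0..1::real}"
  define G where "G = (\<lambda>(x, y, z). C (x * y * z) - F x - F y - F z)"
  have "continuous_on ?Q G"
    unfolding G_def case_prod_beta
    by (intro continuous_intros continuous_on_compose2[OF C_cont] continuous_on_compose2[OF F_cont])
      (auto intro!: mult_le_one mult_nonneg_nonneg)
  then obtain a b c where abc: "a \<in> {0..1}" "b \<in> {0..1}" "c \<in> {0..1}"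
      and min: "\<And>u v w. u \<in> {0..1} \<Longrightarrow> v \<in> {0..1} \<Longrightarrow> w \<in> {0..1} \<Longrightarrow> G (a, b, c) \<le> G (u, v, w)"
    using continuous_attains_inf[of ?Q G] by (auto simp: compact_Times)
  have "b * c = lam a"
  proof (rule minimizer_lam)
    show "C (a * (b * c)) - F a \<le> C (u * (b * c)) - F u" if "u \<in> {0..1}" for u
      using min[of u b c] that abc by (simp add: G_def mult_ac)
  qed (use abc mult_in_unit in auto)
  moreover have "a * c = lam b"
  proof (rule minimizer_lam)
    show "C (b * (a * c)) - F b \<le> C (u * (a * c)) - F u" if "u \<in> {0..1}" for u
      using min[of a u c] that abc by (simp add: G_def mult_ac)
  qed (use abc mult_in_unit in auto)
  moreover have "a * b = lam c"
  proof (rule minimizer_lam)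
    show "C (c * (a * b)) - F c \<le> C (u * (a * b)) - F u" if "u \<in> {0..1}" for u
      using min[of a b u] that abc by (simp add: G_def mult_ac)
  qed (use abc mult_in_unit in auto)
  ultimately have "contact a b c" using abc by (auto simp: contact_def)
  from contact_value[OF this] min[OF assms] show ?thesis by (simp add: G_def)
qed

section \<open>The optimal value for continuous triples\<close>

text \<open>The contact set is invariant under rotation. Adding the three rotated inequalities and
  subtracting \<open>contact_value\<close> three times gives the hypothesis of
  \<open>contact_integral_nonpos\<close> for a single function.\<close>

lemma continuous_value_le:
  assumes f: "continuous_on {0..1} f" and g: "continuous_on {0..1} g" and h: "continuous_on {0..1} h"
    and le: "\<And>x y z. contact x y z \<Longrightarrow> f x + g y + h z \<le> C (x * y * z)"
  shows "integral {0..1} f + integral {0..1} g + integral {0..1} h \<le> 3 * integral {0..1} F + K"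
proof -
  note int = integrable_continuous_real[OF f] integrable_continuous_real[OF g]
    integrable_continuous_real[OF h] integrable_continuous_real[OF F_cont]
  have "integral {0..1} (\<lambda>x. f x + g x + h x - (3 * F x + K)) \<le> 0"
  proof (rule contact_integral_nonpos)
    show "continuous_on {0..1} (\<lambda>x. f x + g x + h x - (3 * F x + K))"
      by (intro continuous_intros f g h F_cont)
    fix x y z assume c: "contact x y z"
    have "f y + g z + h x \<le> C (x * y * z)" "f z + g x + h y \<le> C (x * y * z)"
      using le[OF contact_rotate[OF c]] le[OF contact_rotate[OF contact_rotate[OF c]]] by (simp_all add: mult_ac)
    with le[OF c] contact_value[OF c]
    show "f x + g x + h x - (3 * F x + K) + (f y + g y + h y - (3 * F y + K))
      + (f z + g z + h z - (3 * F z + K)) \<le> 0"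
      by simp
  qed
  also have "integral {0..1} (\<lambda>x. f x + g x + h x - (3 * F x + K))
      = integral {0..1} f + integral {0..1} g + integral {0..1} h - (3 * integral {0..1} F + K)"
    by (intro integral_unique has_integral_diff[OF has_integral_add[OF has_integral_add]
          has_integral_add[OF has_integral_mult_right]] integrable_integral int)
      (use has_integral_const_real[of K 0 1] in simp)
  finally show ?thesis by simp
qed

text \<open>If equality failed on the whole slice over \<open>x0\<close>, then by compactness \<open>f\<close> could be raised by a small
  bump near \<open>x0\<close> without leaving the class of \<open>continuous_value_le\<close>.\<close>

lemma contact_attained:
  assumes f: "continuous_on {0..1} f" and g: "continuous_on {0..1} g" and h: "continuous_on {0..1} h"
    and le: "\<And>x y z. x \<in> {0..1} \<Longrightarrow> y \<in> {0..1} \<Longrightarrow> z \<in> {0..1} \<Longrightarrow> f x + g y + h z \<le> C (x * y * z)"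
    and opt: "integral {0..1} f + integral {0..1} g + integral {0..1} h = 3 * integral {0..1} F + K"
    and x0: "x0 \<in> {0..1}"
  obtains y z where "y \<in> {0..1}" "z \<in> {0..1}" "y * z = lam x0" "f x0 + g y + h z = C (x0 * y * z)"
proof (rule ccontr)
  assume "\<not> thesis"
  with that have no: "f x0 + g y + h z \<noteq> C (x0 * y * z)"
    if "y \<in> {0..1}" "z \<in> {0..1}" "y * z = lam x0" for y z using that by blast
  let ?Q = "{0..1::real} \<times> {0..1::real} \<times> {0..1::real}"
  define H where "H = (\<lambda>(x, y, z). C (x * y * z) - f x - g y - h z)"
  define M where "M = (\<lambda>(x, y, z). y * z - lam x)"
  have H_cont: "continuous_on ?Q H"
    unfolding H_def case_prod_beta
    by (intro continuous_intros continuous_on_compose2[OF C_cont] continuous_on_compose2[OF f]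
        continuous_on_compose2[OF g] continuous_on_compose2[OF h])
      (auto intro!: mult_le_one mult_nonneg_nonneg)
  have M_cont: "continuous_on ?Q M"
    unfolding M_def case_prod_beta
    by (intro continuous_intros continuous_on_compose2[OF continuous_on_lam]) auto
  have Q: "compact ?Q" by (intro compact_Times) auto
  then have "closed ?Q" by (rule compact_imp_closed)
  \<comment> \<open>Only the first contact equation is kept; \<open>P\<close> is compact and
    contains all contact points.\<close>
  define P where "P = {p \<in> ?Q. M p = 0}"
  have "closed P" unfolding P_def
    by (rule continuous_closed_preimage_constant[OF M_cont \<open>closed ?Q\<close>])
  then have P: "compact P" "P \<subseteq> ?Q"
    using compact_Int_closed[OF Q \<open>closed P\<close>] by (auto simp: P_def Int_absorb1)
  have HP_cont: "continuous_on P H" using H_cont P(2) by (rule continuous_on_subset)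
  have "closed {p \<in> P. H p = 0}"
    by (rule continuous_closed_preimage_constant[OF HP_cont \<open>closed P\<close>])
  then have "compact (P \<inter> {p \<in> P. H p = 0})" by (rule compact_Int_closed[OF P(1)])
  \<comment> \<open>The first coordinates of the equality points form a closed set, so a whole ball
    around \<open>x0\<close> avoids it.\<close>
  then have "compact (fst ` (P \<inter> {p \<in> P. H p = 0}))"
    by (intro compact_continuous_image continuous_intros)
  then have "open (- (fst ` (P \<inter> {p \<in> P. H p = 0})))"
    by (simp add: compact_imp_closed open_Compl)
  moreover have "x0 \<in> - (fst ` (P \<inter> {p \<in> P. H p = 0}))"
    using no by (force simp: P_def M_def H_def)
  ultimately obtain d where d: "0 < d" "cball x0 d \<subseteq> - (fst ` (P \<inter> {p \<in> P. H p = 0}))"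
    unfolding open_contains_cball by blast
  define R where "R = P \<inter> {p \<in> P. fst p \<in> cball x0 d}"
  have "closed {p \<in> P. fst p \<in> cball x0 d}"
    using continuous_closed_preimage[OF _ \<open>closed P\<close> closed_cball, of fst x0 d]
    by (simp add: continuous_on_fst vimage_def Int_def)
  then have "compact R" unfolding R_def by (rule compact_Int_closed[OF P(1)])
  have pos: "0 < H p" if "p \<in> R" for p
  proof -
    have "p \<in> ?Q" using that P(2) by (auto simp: R_def)
    then have "0 \<le> H p"
      using le[of "fst p" "fst (snd p)" "snd (snd p)"] by (auto simp: H_def)
    moreover have "H p \<noteq> 0" using that d(2) by (auto simp: R_def)
    ultimately show ?thesis by simp
  qed
  obtain e where e: "0 < e" "\<And>p. p \<in> R \<Longrightarrow> e \<le> H p"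
  proof (cases "R = {}")
    case True
    then show ?thesis using that[of 1] by simp
  next
    case False
    have "continuous_on R H" using HP_cont by (rule continuous_on_subset) (auto simp: R_def)
    from continuous_attains_inf[OF \<open>compact R\<close> False this]
    obtain p where "p \<in> R" "\<forall>q\<in>R. H p \<le> H q" by blast
    then show ?thesis using that[of "H p"] pos by blast
  qed
  \<comment> \<open>A tent of height \<open>e\<close> over the ball of radius \<open>d\<close>;
    above this ball every point of \<open>P\<close> has slack at least \<open>e\<close>.\<close>
  define b where "b x = e * max 0 (1 - \<bar>x - x0\<bar> / d)" for x
  have b_cont: "continuous_on {0..1} b"
    unfolding b_def using d(1) by (intro continuous_intros) auto
  have b_nonneg: "0 \<le> b x" for x using e(1) by (simp add: b_def)
  have "integral {0..1} b \<noteq> 0"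
    using integral_eq_0_iff[OF b_cont] b_nonneg x0 e(1) by (force simp: b_def)
  moreover have "0 \<le> integral {0..1} b"
    using b_nonneg by (intro integral_nonneg integrable_continuous_real b_cont)
  moreover have "integral {0..1} (\<lambda>x. f x + b x) + integral {0..1} g + integral {0..1} h
      \<le> 3 * integral {0..1} F + K"
  proof (rule continuous_value_le)
    show "continuous_on {0..1} (\<lambda>x. f x + b x)" by (intro continuous_intros f b_cont)
    fix x y z assume c: "contact x y z"
    then have p: "(x, y, z) \<in> P" by (auto simp: P_def M_def contact_def)
    show "f x + b x + g y + h z \<le> C (x * y * z)"
    proof (cases "\<bar>x - x0\<bar> \<le> d")
      case True
      with p have "(x, y, z) \<in> R" by (simp add: R_def dist_real_def abs_minus_commute)
      moreover have "b x \<le> e * 1" unfolding b_def using e(1) d(1) by (intro mult_left_mono) auto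
      ultimately show ?thesis using e(2) by (fastforce simp: H_def)
    next
      case False
      then have "b x = 0" using d(1) by (simp add: b_def max_def field_simps)
      then show ?thesis using le[of x y z] c by (auto simp: contact_def)
    qed
  qed (use g h in auto)
  moreover have "integral {0..1} (\<lambda>x. f x + b x) = integral {0..1} f + integral {0..1} b"
    by (intro integral_add integrable_continuous_real f b_cont)
  ultimately show False using opt by simp
qed

section \<open>Uniqueness among continuous triples\<close>

lemma scaled_mvt:
  assumes "w \<in> {0..1}" "a \<in> {0..1}" "b \<in> {0..1}"
  obtains t where "t \<in> {0..1}" "\<bar>t - a\<bar> \<le> \<bar>b - a\<bar>" "C (b * w) - C (a * w) = (b - a) * (w * D (t * w))"
proof -
  have *: "\<exists>t\<in>{u..v}. C (v * w) - C (u * w) = D (t * w) * w * (v - u)" if "0 \<le> u" "u \<le> v" "v \<le> 1" for u v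
  proof (rule mvt_very_simple[OF \<open>u \<le> v\<close>])
    fix x assume "u \<le> x" "x \<le> v"
    then have "((\<lambda>x. C (x * w)) has_real_derivative D (x * w) * w) (at x within {u..v})"
      using that assms(1) by (intro has_field_derivative_subset[OF scaled_deriv]) auto
    then show "((\<lambda>x. C (x * w)) has_derivative (*) (D (x * w) * w)) (at x within {u..v})"
      by (simp add: has_field_derivative_def)
  qed
  show thesis
  proof (cases "a \<le> b")
    case True
    with *[of a b] assms obtain t where "t \<in> {a..b}" "C (b * w) - C (a * w) = D (t * w) * w * (b - a)" by auto
    then show thesis using assms by (intro that[of t]) (auto simp: mult_ac)
  next
    case False
    with *[of b a] assms obtain t where t: "t \<in> {b..a}" "C (a * w) - C (b * w) = D (t * w) * w * (a - b)" by auto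
    then show thesis using assms False by (intro that[of t]) (auto simp: algebra_simps)
  qed
qed

text \<open>Moving only the first coordinate of the equality point over \<open>u\<close> from
  \<open>u\<close> to \<open>v\<close> bounds \<open>f v - f u\<close> from above; exchanging
  \<open>u\<close> and \<open>v\<close> bounds it from below. By the mean value theorem both bounds
  are \<open>v - u\<close> times values of \<open>k\<close> near the diagonal, which fixes the
  derivative of \<open>f\<close>.\<close>

lemma optimal_eq_potential:
  assumes f: "continuous_on {0..1} f" and g: "continuous_on {0..1} g" and h: "continuous_on {0..1} h"
    and le: "\<And>x y z. x \<in> {0..1} \<Longrightarrow> y \<in> {0..1} \<Longrightarrow> z \<in> {0..1} \<Longrightarrow> f x + g y + h z \<le> C (x * y * z)"
    and opt: "integral {0..1} f + integral {0..1} g + integral {0..1} h = 3 * integral {0..1} F + K"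
  obtains c where "\<And>x. x \<in> {0..1} \<Longrightarrow> f x = F x + c"
proof -
  \<comment> \<open>\<open>k (s, t)\<close> is the derivative of \<open>C (t * lam s)\<close> in
    \<open>t\<close>; on the diagonal it is the derivative of \<open>F\<close>.\<close>
  define k where "k = (\<lambda>(s, t). lam s * D (t * lam s))"
  let ?S = "{0..1::real} \<times> {0..1::real}"
  have k_cont: "continuous_on ?S k"
    unfolding k_def case_prod_beta
    by (intro continuous_intros continuous_on_compose2[OF cont] continuous_on_compose2[OF continuous_on_lam])
      (auto intro!: mult_le_one mult_nonneg_nonneg lam_bounds)
  have "compact ?S" by (intro compact_Times) auto
  from compact_uniformly_continuous[OF k_cont this] have k_unif: "uniformly_continuous_on ?S k" .
  have slope: "f v - f u \<le> C (v * lam u) - C (u * lam u)" if u: "u \<in> {0..1}" and v: "v \<in> {0..1}" for u v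
  proof -
    obtain y z where yz: "y \<in> {0..1}" "z \<in> {0..1}" "y * z = lam u" "f u + g y + h z = C (u * y * z)"
      by (rule contact_attained[OF f g h le opt u])
    with le[OF v yz(1,2)] show ?thesis by (simp add: mult.assoc)
  qed
  have f_deriv: "(f has_real_derivative k (x, x)) (at x within {0..1})" if x: "x \<in> {0..1}" for x
    unfolding has_field_derivative_def has_derivative_within_alt
  proof (intro conjI allI impI bounded_linear_mult_right)
    fix e :: real assume "0 < e"
    then obtain d where d: "0 < d" "\<And>p q. p \<in> ?S \<Longrightarrow> q \<in> ?S \<Longrightarrow> dist q p < d \<Longrightarrow> dist (k q) (k p) < e"
      using k_unif unfolding uniformly_continuous_on_def by metis
    have "norm (f v - f x - k (x, x) * (v - x)) \<le> e * norm (v - x)"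
      if v: "v \<in> {0..1}" "norm (v - x) < d/2" for v
    proof -
      obtain s where s: "s \<in> {0..1}" "\<bar>s - x\<bar> \<le> \<bar>v - x\<bar>" "C (v * lam x) - C (x * lam x) = (v - x) * k (x, s)"
        using scaled_mvt[of "lam x" x v] lam_bounds[OF x] x v by (auto simp: k_def)
      obtain t where t: "t \<in> {0..1}" "\<bar>t - x\<bar> \<le> \<bar>v - x\<bar>" "C (v * lam v) - C (x * lam v) = (v - x) * k (v, t)"
        using scaled_mvt[of "lam v" x v] lam_bounds[OF v(1)] x v by (auto simp: k_def)
      have "dist (a, b) (x, x) < d" if "\<bar>a - x\<bar> \<le> \<bar>v - x\<bar>" "\<bar>b - x\<bar> \<le> \<bar>v - x\<bar>" for a b
      proof -
        have "dist (a, b) (x, x) \<le> \<bar>a - x\<bar> + \<bar>b - x\<bar>"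
          using sqrt_sum_squares_le_sum_abs[of "a - x" "b - x"] by (simp add: dist_Pair_Pair dist_real_def)
        then show ?thesis using that v(2) by simp
      qed
      then have "dist (k (x, s)) (k (x, x)) < e" "dist (k (v, t)) (k (x, x)) < e"
        using s t v x by (auto intro!: d(2))
      then have near: "\<bar>(v - x) * (k (x, s) - k (x, x))\<bar> \<le> e * \<bar>v - x\<bar>"
        "\<bar>(v - x) * (k (v, t) - k (x, x))\<bar> \<le> e * \<bar>v - x\<bar>"
        by (auto simp: abs_mult dist_real_def mult.commute[of e] intro!: mult_left_mono)
      have "f v - f x \<le> (v - x) * k (x, s)" "(v - x) * k (v, t) \<le> f v - f x"
        using slope[OF x v(1)] slope[OF v(1) x] s(3) t(3) by auto
      then have "f v - f x - k (x, x) * (v - x) \<le> (v - x) * (k (x, s) - k (x, x))"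
        "(v - x) * (k (v, t) - k (x, x)) \<le> f v - f x - k (x, x) * (v - x)"
        by (auto simp: algebra_simps)
      with near show ?thesis by (simp only: real_norm_def)
    qed
    then show "\<exists>d>0. \<forall>v\<in>{0..1}. norm (v - x) < d \<longrightarrow> norm (f v - f x - k (x, x) * (v - x)) \<le> e * norm (v - x)"
      using d(1) by (intro exI[of _ "d/2"]) auto
  qed
  have "\<exists>c. \<forall>x\<in>{0..1}. f x - F x = c"
  proof (rule has_field_derivative_zero_constant)
    fix x :: real assume x: "x \<in> {0..1}"
    show "((\<lambda>x. f x - F x) has_real_derivative 0) (at x within {0..1})"
      using DERIV_diff[OF f_deriv[OF x] F_deriv[OF x]] by (simp add: k_def)
  qed simp
  then obtain c where "\<forall>x\<in>{0..1}. f x - F x = c" by blast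
  then show thesis by (intro that[of c]) (auto simp: algebra_simps)
qed

section \<open>From continuous to integrable triples\<close>

text \<open>The functions are conjugated one after the other, each against the ones already
  replaced, so feasibility is kept throughout.\<close>

lemma continuous_majorants:
  assumes "\<And>x y z. x \<in> {0..1} \<Longrightarrow> y \<in> {0..1} \<Longrightarrow> z \<in> {0..1} \<Longrightarrow> f x + g y + h z \<le> C (x * y * z)"
  obtains f' g' h' where "continuous_on {0..1} f'" "continuous_on {0..1} g'" "continuous_on {0..1} h'"
    "\<And>x. x \<in> {0..1} \<Longrightarrow> f x \<le> f' x" "\<And>x. x \<in> {0..1} \<Longrightarrow> g x \<le> g' x" "\<And>x. x \<in> {0..1} \<Longrightarrow> h x \<le> h' x"
    "\<And>x y z. x \<in> {0..1} \<Longrightarrow> y \<in> {0..1} \<Longrightarrow> z \<in> {0..1} \<Longrightarrow> f' x + g' y + h' z \<le> C (x * y * z)"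
proof -
  obtain f' where f': "continuous_on {0..1} f'" "\<And>x. x \<in> {0..1} \<Longrightarrow> f x \<le> f' x"
    "\<And>x y z. x \<in> {0..1} \<Longrightarrow> y \<in> {0..1} \<Longrightarrow> z \<in> {0..1} \<Longrightarrow> f' x + g y + h z \<le> C (x * y * z)"
    using conjugate_exists[OF C_cont assms] by blast
  have "g y + f' x + h z \<le> C (y * x * z)" if "y \<in> {0..1}" "x \<in> {0..1}" "z \<in> {0..1}" for x y z
    using f'(3)[OF that(2,1,3)] by (simp add: mult_ac)
  from conjugate_exists[OF C_cont this]
  obtain g' where g': "continuous_on {0..1} g'" "\<And>x. x \<in> {0..1} \<Longrightarrow> g x \<le> g' x"
    "\<And>y x z. y \<in> {0..1} \<Longrightarrow> x \<in> {0..1} \<Longrightarrow> z \<in> {0..1} \<Longrightarrow> g' y + f' x + h z \<le> C (y * x * z)"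
    by blast
  have "h z + f' x + g' y \<le> C (z * x * y)" if "z \<in> {0..1}" "x \<in> {0..1}" "y \<in> {0..1}" for x y z
    using g'(3)[OF that(3,2,1)] by (simp add: mult_ac)
  from conjugate_exists[OF C_cont this]
  obtain h' where h': "continuous_on {0..1} h'" "\<And>x. x \<in> {0..1} \<Longrightarrow> h x \<le> h' x"
    "\<And>z x y. z \<in> {0..1} \<Longrightarrow> x \<in> {0..1} \<Longrightarrow> y \<in> {0..1} \<Longrightarrow> h' z + f' x + g' y \<le> C (z * x * y)"
    by blast
  have le: "f' x + g' y + h' z \<le> C (x * y * z)" if "x \<in> {0..1}" "y \<in> {0..1}" "z \<in> {0..1}" for x y z
    using h'(3)[OF that(3,1,2)] by (simp add: mult_ac)
  show thesis by (rule that[OF f'(1) g'(1) h'(1) f'(2) g'(2) h'(2) le])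
qed

abbreviation "LI f \<equiv> integral\<^sup>L (lebesgue_on {0..1}) f"
abbreviation "cost \<equiv> (\<lambda>x y z. C (x * y * z))"

lemma lebesgue_integral_continuous:
  fixes f :: "real \<Rightarrow> real"
  assumes "continuous_on {0..1} f"
  shows "integrable (lebesgue_on {0..1}) f" "LI f = integral {0..1} f"
  using continuous_imp_integrable_real[OF assms] by (auto intro: lebesgue_integral_eq_integral)

lemma dual_value_le:
  assumes "dual_feasible cost f g h"
  shows "dual_value f g h \<le> 3 * LI F + K"
proof -
  obtain f' g' h' where c: "continuous_on {0..1} f'" "continuous_on {0..1} g'" "continuous_on {0..1} h'"
    and ge: "\<And>x. x \<in> {0..1} \<Longrightarrow> f x \<le> f' x" "\<And>x. x \<in> {0..1} \<Longrightarrow> g x \<le> g' x" "\<And>x. x \<in> {0..1} \<Longrightarrow> h x \<le> h' x"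
    and le: "\<And>x y z. x \<in> {0..1} \<Longrightarrow> y \<in> {0..1} \<Longrightarrow> z \<in> {0..1} \<Longrightarrow> f' x + g' y + h' z \<le> C (x * y * z)"
    using continuous_majorants[of f g h] assms unfolding dual_feasible_def by blast
  have "LI f \<le> LI f'" "LI g \<le> LI g'" "LI h \<le> LI h'"
    using assms lebesgue_integral_continuous(1) c ge
    by (auto simp: dual_feasible_def intro!: integral_mono)
  moreover have "integral {0..1} f' + integral {0..1} g' + integral {0..1} h' \<le> 3 * integral {0..1} F + K"
  proof (rule continuous_value_le[OF c])
    show "f' x + g' y + h' z \<le> C (x * y * z)" if "contact x y z" for x y z
      using that le[of x y z] unfolding contact_def by blast
  qed
  ultimately show ?thesis
    using lebesgue_integral_continuous(2) c F_cont by (simp add: dual_value_def)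
qed

lemma lebesgue_integral_potential_add: "LI (\<lambda>x. F x + c) = LI F + c"
proof -
  have "LI (\<lambda>x. F x + c) = integral {0..1} (\<lambda>x. F x + c)"
    by (intro lebesgue_integral_continuous continuous_intros F_cont)
  also have "\<dots> = integral {0..1} F + c"
    using integral_add[OF integrable_continuous_real[OF F_cont] integrable_const_ivl[of c]] by simp
  finally show ?thesis using lebesgue_integral_continuous(2)[OF F_cont] by simp
qed

lemma potential_dual_feasible:
  "dual_feasible cost (\<lambda>x. F x + K) F F" "dual_value (\<lambda>x. F x + K) F F = 3 * LI F + K"
proof -
  have "F x + K + F y + F z \<le> C (x * y * z)" if "x \<in> {0..1}" "y \<in> {0..1}" "z \<in> {0..1}" for x y z
    using potential_feasible[OF that] by simp
  then show "dual_feasible cost (\<lambda>x. F x + K) F F"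
    unfolding dual_feasible_def
    by (intro conjI ballI lebesgue_integral_continuous(1) continuous_intros F_cont) auto
  show "dual_value (\<lambda>x. F x + K) F F = 3 * LI F + K"
    by (simp only: dual_value_def lebesgue_integral_potential_add)
qed

lemma AE_eq_majorant:
  fixes f f' :: "real \<Rightarrow> real"
  assumes "integrable (lebesgue_on {0..1}) f" "integrable (lebesgue_on {0..1}) f'"
    and "\<And>x. x \<in> {0..1} \<Longrightarrow> f x \<le> f' x" "LI f = LI f'"
  shows "AE x in lebesgue_on {0..1}. f x = f' x"
proof -
  have "LI (\<lambda>x. f' x - f x) = 0" using assms by simp
  moreover have "AE x in lebesgue_on {0..1}. 0 \<le> f' x - f x" using assms(3) by (intro AE_I2) simp
  ultimately have "AE x in lebesgue_on {0..1}. f' x - f x = 0"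
    using integral_nonneg_eq_0_iff_AE[of "lebesgue_on {0..1}" "\<lambda>x. f' x - f x"] assms(1,2) by simp
  then show ?thesis by eventually_elim simp
qed

lemma dual_solution_iff:
  "dual_solution cost f g h \<longleftrightarrow>
    (\<exists>Cf Cg Ch. Cf + Cg + Ch = K \<and>
      (\<forall>x\<in>{0..1}. f x \<le> F x + Cf) \<and> (\<forall>y\<in>{0..1}. g y \<le> F y + Cg) \<and> (\<forall>z\<in>{0..1}. h z \<le> F z + Ch) \<and>
      (AE x in lebesgue_on {0..1}. f x = F x + Cf) \<and> (AE y in lebesgue_on {0..1}. g y = F y + Cg) \<and>
      (AE z in lebesgue_on {0..1}. h z = F z + Ch))"
  (is "_ \<longleftrightarrow> (\<exists>Cf Cg Ch. ?P Cf Cg Ch)")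
proof
  assume "dual_solution cost f g h"
  then have feas: "dual_feasible cost f g h" and "3 * LI F + K \<le> dual_value f g h"
    using potential_dual_feasible unfolding dual_solution_def by (blast, metis)
  then have int: "integrable (lebesgue_on {0..1}) f" "integrable (lebesgue_on {0..1}) g"
      "integrable (lebesgue_on {0..1}) h"
    by (auto simp: dual_feasible_def)
  obtain f' g' h' where c: "continuous_on {0..1} f'" "continuous_on {0..1} g'" "continuous_on {0..1} h'"
    and ge: "\<And>x. x \<in> {0..1} \<Longrightarrow> f x \<le> f' x" "\<And>x. x \<in> {0..1} \<Longrightarrow> g x \<le> g' x" "\<And>x. x \<in> {0..1} \<Longrightarrow> h x \<le> h' x"
    and le: "\<And>x y z. x \<in> {0..1} \<Longrightarrow> y \<in> {0..1} \<Longrightarrow> z \<in> {0..1} \<Longrightarrow> f' x + g' y + h' z \<le> C (x * y * z)"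
    using continuous_majorants[of f g h] feas unfolding dual_feasible_def by blast
  note int' = lebesgue_integral_continuous(1)[OF c(1)] lebesgue_integral_continuous(1)[OF c(2)]
    lebesgue_integral_continuous(1)[OF c(3)]
  have "LI f \<le> LI f'" "LI g \<le> LI g'" "LI h \<le> LI h'"
    using int int' ge by (auto intro!: integral_mono)
  moreover have "dual_value f' g' h' \<le> 3 * LI F + K"
    using int' le by (intro dual_value_le) (auto simp: dual_feasible_def)
  \<comment> \<open>Each integral can only grow when passing to the majorant and the total cannot
    exceed the optimum, so none of them grows.\<close>
  ultimately have eq: "LI f = LI f'" "LI g = LI g'" "LI h = LI h'" "LI f' + LI g' + LI h' = 3 * LI F + K"
    using \<open>3 * LI F + K \<le> dual_value f g h\<close> unfolding dual_value_def by linarith+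
  have opt: "integral {0..1} f' + integral {0..1} g' + integral {0..1} h' = 3 * integral {0..1} F + K"
    using eq(4) lebesgue_integral_continuous(2) c F_cont by simp
  from optimal_eq_potential[OF c le opt]
  obtain Cf where Cf: "\<And>x. x \<in> {0..1} \<Longrightarrow> f' x = F x + Cf" by blast
  \<comment> \<open>\<open>optimal_eq_potential\<close> determines only the first function; the
    other two are reached by rotating the triple.\<close>
  have le': "g' y + h' z + f' x \<le> C (y * z * x)" if "y \<in> {0..1}" "z \<in> {0..1}" "x \<in> {0..1}" for x y z
    using le[OF that(3,1,2)] by (simp add: mult_ac)
  have "integral {0..1} g' + integral {0..1} h' + integral {0..1} f' = 3 * integral {0..1} F + K"
    using opt by simp
  from optimal_eq_potential[OF c(2,3,1) le' this]
  obtain Cg where Cg: "\<And>x. x \<in> {0..1} \<Longrightarrow> g' x = F x + Cg" by blast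
  have le'': "h' z + f' x + g' y \<le> C (z * x * y)" if "z \<in> {0..1}" "x \<in> {0..1}" "y \<in> {0..1}" for x y z
    using le[OF that(2,3,1)] by (simp add: mult_ac)
  have "integral {0..1} h' + integral {0..1} f' + integral {0..1} g' = 3 * integral {0..1} F + K"
    using opt by simp
  from optimal_eq_potential[OF c(3,1,2) le'' this]
  obtain Ch where Ch: "\<And>x. x \<in> {0..1} \<Longrightarrow> h' x = F x + Ch" by blast
  \<comment> \<open>Comparing total integrals over an interval of length 1 fixes the sum of the
    three constants.\<close>
  have "LI f' = LI (\<lambda>x. F x + Cf)" "LI g' = LI (\<lambda>x. F x + Cg)" "LI h' = LI (\<lambda>x. F x + Ch)"
    using Cf Cg Ch by (auto intro!: Bochner_Integration.integral_cong)
  then have sum: "Cf + Cg + Ch = K" using eq(4) by (simp add: lebesgue_integral_potential_add)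
  have AE: "AE x in lebesgue_on {0..1}. u x = F x + a"
    if "AE x in lebesgue_on {0..1}. u x = u' x" "\<And>x. x \<in> {0..1} \<Longrightarrow> u' x = F x + a" for u u' a
    using AE_space that(1) by eventually_elim (use that(2) in simp)
  have "?P Cf Cg Ch"
    using sum ge Cf Cg Ch AE[OF AE_eq_majorant[OF int(1) int'(1) ge(1) eq(1)] Cf]
      AE[OF AE_eq_majorant[OF int(2) int'(2) ge(2) eq(2)] Cg]
      AE[OF AE_eq_majorant[OF int(3) int'(3) ge(3) eq(3)] Ch] by auto
  then show "\<exists>Cf Cg Ch. ?P Cf Cg Ch" by blast
next
  assume "\<exists>Cf Cg Ch. ?P Cf Cg Ch"
  then obtain Cf Cg Ch where P: "?P Cf Cg Ch" by blast
  have aux: "integrable (lebesgue_on {0..1}) u" "LI u = LI F + a"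
    if "AE x in lebesgue_on {0..1}. u x = F x + a" for u a
  proof -
    have i: "integrable (lebesgue_on {0..1}) (\<lambda>x. F x + a)"
      by (intro lebesgue_integral_continuous continuous_intros F_cont)
    have m: "u \<in> borel_measurable (lebesgue_on {0..1})"
      using borel_measurable_unit_AE[OF borel_measurable_integrable[OF i] that] .
    show "integrable (lebesgue_on {0..1}) u"
      using that by (intro integrable_cong_AE_imp[OF i m]) (auto simp: eq_commute)
    show "LI u = LI F + a"
      unfolding lebesgue_integral_potential_add[symmetric]
      by (intro integral_cong_AE m borel_measurable_integrable[OF i] that)
  qed
  have "f x + g y + h z \<le> C (x * y * z)" if x: "x \<in> {0..1}" and y: "y \<in> {0..1}" and z: "z \<in> {0..1}" for x y z
  proof -
    have "f x \<le> F x + Cf" "g y \<le> F y + Cg" "h z \<le> F z + Ch" using P x y z by blast+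
    with potential_feasible[OF x y z] P show ?thesis by linarith
  qed
  then have "dual_feasible cost f g h" using P aux(1) unfolding dual_feasible_def by blast
  moreover have "dual_value f g h = 3 * LI F + K"
    using P aux(2)[of f Cf] aux(2)[of g Cg] aux(2)[of h Ch] by (simp add: dual_value_def)
  ultimately show "dual_solution cost f g h"
    unfolding dual_solution_def using dual_value_le by simp
qed

end

theorem theorem5p1:
  fixes C C' f g h :: "real \<Rightarrow> real"
  assumes deriv: "\<And>t. t \<in> {0..1} \<Longrightarrow> (C has_real_derivative C' t) (at t within {0..1})"
    and cont: "continuous_on {0..1} C'"
    and mono: "strict_mono_on {0..1} (\<lambda>t. t * C' t)"
  shows "dual_solution (\<lambda>x y z. C (x * y * z)) f g h \<longleftrightarrow>
    (\<exists>Cf Cg Ch :: real.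
      Cf + Cg + Ch = C 0 - 2 * lam_potential C' 1 \<and>
      (\<forall>x\<in>{0..1}. f x \<le> lam_potential C' x + Cf) \<and>
      (\<forall>y\<in>{0..1}. g y \<le> lam_potential C' y + Cg) \<and>
      (\<forall>z\<in>{0..1}. h z \<le> lam_potential C' z + Ch) \<and>
      (AE x in lebesgue_on {0..1}. f x = lam_potential C' x + Cf) \<and>
      (AE y in lebesgue_on {0..1}. g y = lam_potential C' y + Cg) \<and>
      (AE z in lebesgue_on {0..1}. h z = lam_potential C' z + Ch))"
proof -
  interpret increasing_cost C C'
    using deriv cont mono by unfold_locales
  show ?thesis by (rule dual_solution_iff)
qed

end
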